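(* Assume the standing setting below. Let $\mathbf A,\mathbf B\in\mathcal A$ be such that $\{\mathrm{ess}(f)\mid f\in\mathcal A_{\mathbf A\mathbf B}\}$ is bounded, and let $K$ be the set of maximal elements of the minor homomorphism poset $(\mathcal A_{\mathbf A\mathbf B}/{\equiv},\le)$. Then $$(\mathcal A_{\mathbf A\mathbf B}/{\equiv},\le)\;\cong\;\biguplus_{[f]\in K}\Pi^\partial_{\mathrm{ess}(f)}.$$
   Context: Standing setting: $\mathbf M$ is a finite algebra, $\mathcal A=\mathbb I\mathbb S\mathbb P(\mathbf M)$ the quasivariety it generates, and some alter ego $\widetilde{\mathbf M}$ yields a logarithmic duality on $\mathcal A$. Here an alter ego $\widetilde{\mathbf M}=\langle M,G,H,R,\mathcal T_{dis}\rangle$ is a discrete topological structure on the universe of $\mathbf M$ whose total operations, partial operations and relations have graphs that are subalgebras of finite powers of $\mathbf M$ (nullary operations are constants; no other operation is constant); $\mathcal X$ is the category of structures isomorphic to closed substructures of nonempty powers of $\widetilde{\mathbf M}$ with continuous structure-preserving maps. Logarithmic duality: all total/partial operations of $\widetilde{\mathbf M}$ are at most unary, $\mathbf A\mapsto\mathcal A(\mathbf A,\mathbf M)$ and $\mathbf X\mapsto\mathcal X(\mathbf X,\widetilde{\mathbf M})$ form a dual equivalence with $\widetilde{\mathbf M}$ injective in $\mathcal X$, and finite coproducts in $\mathcal X$ are direct unions (disjoint unions with constants amalgamated). Notation: $[n]=\{1,\dots,n\}$; for $\tau\colon[n]\to[m]$, $\tau^A(a_1,\dots,a_m)=(a_{\tau(1)},\dots,a_{\tau(n)})$;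 $g\preceq f$ iff $g=f\circ\tau^A$ for some $\tau$; $\equiv$ is the induced equivalence and $[g]\le[f]$ iff $g\preceq f$. $\mathrm{ess}(f)$ is the number of essential arguments of $f$ (the $i$-th argument is essential if some $a,b$ differing only in coordinate $i$ have $f(a)\ne f(b)$). $\mathcal A_{\mathbf A\mathbf B}=\bigcup_{n\ge1}\mathcal A(\mathbf A^n,\mathbf B)$. $\Pi_k$ is the lattice of partitions of $[k]$ ordered by refinement ($\Pi_0=\{\varnothing\}$), $\Pi_k^\partial$ its order dual, and $\biguplus$ denotes the disjoint union of posets (no comparabilities between distinct summands). *)

theory Defs
  imports "HOL-Analysis.Analysis" "HOL-Library.Disjoint_Sets"
begin

text \<open>A signature is a partial map: \<open>\<sigma> s = Some n\<close> means that \<open>s\<close> is an operation symbol of arity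
  \<open>n\<close>. Operations act on argument lists; only lists of the correct length over the universe matter.\<close>

record ('a, 'f) alg =
  universe :: "'a set"
  oper :: "'f \<Rightarrow> 'a list \<Rightarrow> 'a"

definition subuniverse :: "('f \<rightharpoonup> nat) \<Rightarrow> 'a set \<Rightarrow> ('a, 'f) alg \<Rightarrow> bool" where
  "subuniverse \<sigma> S A \<longleftrightarrow> S \<subseteq> universe A \<and>
     (\<forall>s n xs. \<sigma> s = Some n \<and> length xs = n \<and> set xs \<subseteq> S \<longrightarrow> oper A s xs \<in> S)"

definition is_algebra :: "('f \<rightharpoonup> nat) \<Rightarrow> ('a, 'f) alg \<Rightarrow> bool" where
  "is_algebra \<sigma> A \<longleftrightarrow> universe A \<noteq> {} \<and> subuniverse \<sigma> (universe A) A"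

definition subalgebra :: "('f \<rightharpoonup> nat) \<Rightarrow> 'a set \<Rightarrow> ('a, 'f) alg \<Rightarrow> bool" where
  "subalgebra \<sigma> S A \<longleftrightarrow> S \<noteq> {} \<and> subuniverse \<sigma> S A"

definition alg_power :: "('a, 'f) alg \<Rightarrow> 'i set \<Rightarrow> ('i \<Rightarrow> 'a, 'f) alg" where
  "alg_power A I = \<lparr> universe = (\<Pi>\<^sub>E i\<in>I. universe A),
                     oper = (\<lambda>s xs. \<lambda>i\<in>I. oper A s (map (\<lambda>x. x i) xs)) \<rparr>"

definition alg_hom :: "('f \<rightharpoonup> nat) \<Rightarrow> ('a, 'f) alg \<Rightarrow> ('b, 'f) alg \<Rightarrow> ('a \<Rightarrow> 'b) set" where
  "alg_hom \<sigma> A B = {f \<in> universe A \<rightarrow>\<^sub>E universe B.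
     \<forall>s n xs. \<sigma> s = Some n \<and> length xs = n \<and> set xs \<subseteq> universe A \<longrightarrow>
       f (oper A s xs) = oper B s (map f xs)}"

definition alg_iso :: "('f \<rightharpoonup> nat) \<Rightarrow> ('a \<Rightarrow> 'b) \<Rightarrow> ('a, 'f) alg \<Rightarrow> ('b, 'f) alg \<Rightarrow> bool" where
  "alg_iso \<sigma> f A B \<longleftrightarrow> f \<in> alg_hom \<sigma> A B \<and> bij_betw f (universe A) (universe B)"

text \<open>Membership in \<open>ISP(M)\<close>; the index set may be empty. HOL needs a type for the indices, and
  \<open>'a \<Rightarrow> 'm\<close> loses nothing: if \<open>A\<close> embeds into some power of \<open>M\<close>, then it embeds into the power
  indexed by the set of all homomorphisms from \<open>A\<close> to \<open>M\<close>.\<close>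

definition in_ISP :: "('f \<rightharpoonup> nat) \<Rightarrow> ('m, 'f) alg \<Rightarrow> ('a, 'f) alg \<Rightarrow> bool" where
  "in_ISP \<sigma> M A \<longleftrightarrow> is_algebra \<sigma> A \<and>
     (\<exists>(I :: ('a \<Rightarrow> 'm) set) S f. subalgebra \<sigma> S (alg_power M I) \<and>
        alg_iso \<sigma> f A ((alg_power M I)\<lparr>universe := S\<rparr>))"

record ('g, 'h, 'r) strsig =
  tot_ar :: "'g \<rightharpoonup> nat"
  par_ar :: "'h \<rightharpoonup> nat"
  rel_ar :: "'r \<rightharpoonup> nat"

record ('x, 'g, 'h, 'r) topstr =
  topo :: "'x topology"
  tot_op :: "'g \<Rightarrow> 'x list \<Rightarrow> 'x"
  par_op :: "'h \<Rightarrow> 'x list \<rightharpoonup> 'x"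
  rels :: "'r \<Rightarrow> 'x list set"

abbreviation points :: "('x, 'g, 'h, 'r) topstr \<Rightarrow> 'x set" where
  "points X \<equiv> topspace (topo X)"

definition is_topstr :: "('g, 'h, 'r) strsig \<Rightarrow> ('x, 'g, 'h, 'r) topstr \<Rightarrow> bool" where
  "is_topstr \<tau> X \<longleftrightarrow>
     (\<forall>g n xs. tot_ar \<tau> g = Some n \<and> length xs = n \<and> set xs \<subseteq> points X \<longrightarrow>
        tot_op X g xs \<in> points X) \<and>
     (\<forall>h n xs y. par_ar \<tau> h = Some n \<and> par_op X h xs = Some y \<longrightarrow>
        length xs = n \<and> set xs \<subseteq> points X \<and> y \<in> points X) \<and>
     (\<forall>r n xs. rel_ar \<tau> r = Some n \<and> xs \<in> rels X r \<longrightarrow> length xs = n \<and> set xs \<subseteq> points X)"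

definition str_power :: "('m, 'g, 'h, 'r) topstr \<Rightarrow> 'i set \<Rightarrow> ('i \<Rightarrow> 'm, 'g, 'h, 'r) topstr" where
  "str_power N I =
     \<lparr> topo = product_topology (\<lambda>i. topo N) I,
       tot_op = (\<lambda>g xs. \<lambda>i\<in>I. tot_op N g (map (\<lambda>x. x i) xs)),
       par_op = (\<lambda>h xs.
         if set xs \<subseteq> (\<Pi>\<^sub>E i\<in>I. points N) \<and> (\<forall>i\<in>I. par_op N h (map (\<lambda>x. x i) xs) \<noteq> None)
         then Some (\<lambda>i\<in>I. the (par_op N h (map (\<lambda>x. x i) xs))) else None),
       rels = (\<lambda>r. {xs. set xs \<subseteq> (\<Pi>\<^sub>E i\<in>I. points N) \<and>
                        (\<forall>i\<in>I. map (\<lambda>x. x i) xs \<in> rels N r)}) \<rparr>"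

definition closed_substr ::
    "('g, 'h, 'r) strsig \<Rightarrow> 'x set \<Rightarrow> ('x, 'g, 'h, 'r) topstr \<Rightarrow> bool" where
  "closed_substr \<tau> S X \<longleftrightarrow> closedin (topo X) S \<and>
     (\<forall>g n xs. tot_ar \<tau> g = Some n \<and> length xs = n \<and> set xs \<subseteq> S \<longrightarrow> tot_op X g xs \<in> S) \<and>
     (\<forall>h n xs y. par_ar \<tau> h = Some n \<and> set xs \<subseteq> S \<and> par_op X h xs = Some y \<longrightarrow> y \<in> S)"

definition str_restrict :: "('x, 'g, 'h, 'r) topstr \<Rightarrow> 'x set \<Rightarrow> ('x, 'g, 'h, 'r) topstr" where
  "str_restrict X S =
     \<lparr> topo = subtopology (topo X) S,
       tot_op = tot_op X,
       par_op = (\<lambda>h xs. if set xs \<subseteq> S then par_op X h xs else None),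
       rels = (\<lambda>r. {xs \<in> rels X r. set xs \<subseteq> S}) \<rparr>"

definition str_hom ::
    "('g, 'h, 'r) strsig \<Rightarrow> ('x, 'g, 'h, 'r) topstr \<Rightarrow> ('y, 'g, 'h, 'r) topstr \<Rightarrow> ('x \<Rightarrow> 'y) set" where
  "str_hom \<tau> X Y = {f \<in> extensional (points X).
     continuous_map (topo X) (topo Y) f \<and>
     (\<forall>g n xs. tot_ar \<tau> g = Some n \<and> length xs = n \<and> set xs \<subseteq> points X \<longrightarrow>
        f (tot_op X g xs) = tot_op Y g (map f xs)) \<and>
     (\<forall>h n xs y. par_ar \<tau> h = Some n \<and> par_op X h xs = Some y \<longrightarrow>
        par_op Y h (map f xs) = Some (f y)) \<and>
     (\<forall>r n xs. rel_ar \<tau> r = Some n \<and> xs \<in> rels X r \<longrightarrow> map f xs \<in> rels Y r)}"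

definition str_iso ::
    "('g, 'h, 'r) strsig \<Rightarrow> ('x \<Rightarrow> 'y) \<Rightarrow> ('x, 'g, 'h, 'r) topstr \<Rightarrow> ('y, 'g, 'h, 'r) topstr \<Rightarrow> bool" where
  "str_iso \<tau> f X Y \<longleftrightarrow> f \<in> str_hom \<tau> X Y \<and>
     (\<exists>f' \<in> str_hom \<tau> Y X. (\<forall>x\<in>points X. f' (f x) = x) \<and> (\<forall>y\<in>points Y. f (f' y) = y))"

definition str_embedding ::
    "('g, 'h, 'r) strsig \<Rightarrow> ('x \<Rightarrow> 'y) \<Rightarrow> ('x, 'g, 'h, 'r) topstr \<Rightarrow> ('y, 'g, 'h, 'r) topstr \<Rightarrow> bool" where
  "str_embedding \<tau> f X Y \<longleftrightarrow>
     (\<exists>S. closed_substr \<tau> S Y \<and> str_iso \<tau> f X (str_restrict Y S))"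

text \<open>Objects of the category of structures isomorphic to closed (possibly empty) substructures of
  nonempty powers of \<open>N\<close>. As before, the index type \<open>'x \<Rightarrow> 'm\<close> is large enough: such a structure
  embeds into the power indexed by its morphisms to \<open>N\<close>.\<close>

definition in_ISP_closed ::
    "('g, 'h, 'r) strsig \<Rightarrow> ('m, 'g, 'h, 'r) topstr \<Rightarrow> ('x, 'g, 'h, 'r) topstr \<Rightarrow> bool" where
  "in_ISP_closed \<tau> N X \<longleftrightarrow> is_topstr \<tau> X \<and>
     (\<exists>(I :: ('x \<Rightarrow> 'm) set) S f. I \<noteq> {} \<and> closed_substr \<tau> S (str_power N I) \<and>
        str_iso \<tau> f X (str_restrict (str_power N I) S))"

definition list_tuple :: "'a list \<Rightarrow> nat \<Rightarrow> 'a" where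
  "list_tuple xs = (\<lambda>i\<in>{..<length xs}. xs ! i)"

definition algebraic_rel :: "('f \<rightharpoonup> nat) \<Rightarrow> ('m, 'f) alg \<Rightarrow> nat \<Rightarrow> 'm list set \<Rightarrow> bool" where
  "algebraic_rel \<sigma> M n R \<longleftrightarrow>
     (\<forall>xs\<in>R. length xs = n) \<and> subalgebra \<sigma> (list_tuple ` R) (alg_power M {..<n})"

definition alter_ego ::
    "('f \<rightharpoonup> nat) \<Rightarrow> ('m, 'f) alg \<Rightarrow> ('g, 'h, 'r) strsig \<Rightarrow> ('m, 'g, 'h, 'r) topstr \<Rightarrow> bool" where
  "alter_ego \<sigma> M \<tau> N \<longleftrightarrow> is_topstr \<tau> N \<and> topo N = discrete_topology (universe M) \<and>
     (\<forall>g n. tot_ar \<tau> g = Some n \<longrightarrow>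
        algebraic_rel \<sigma> M (Suc n)
          {xs @ [tot_op N g xs] | xs. length xs = n \<and> set xs \<subseteq> universe M} \<and>
        (n > 0 \<longrightarrow>
          \<not> (\<exists>c. \<forall>xs. length xs = n \<and> set xs \<subseteq> universe M \<longrightarrow> tot_op N g xs = c))) \<and>
     (\<forall>h n. par_ar \<tau> h = Some n \<longrightarrow>
        algebraic_rel \<sigma> M (Suc n) {xs @ [y] | xs y. par_op N h xs = Some y}) \<and>
     (\<forall>r n. rel_ar \<tau> r = Some n \<longrightarrow> algebraic_rel \<sigma> M n (rels N r))"

definition dual_str ::
    "('f \<rightharpoonup> nat) \<Rightarrow> ('m, 'f) alg \<Rightarrow> ('m, 'g, 'h, 'r) topstr \<Rightarrow> ('a, 'f) alg \<Rightarrow>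
     ('a \<Rightarrow> 'm, 'g, 'h, 'r) topstr" where
  "dual_str \<sigma> M N A = str_restrict (str_power N (universe A)) (alg_hom \<sigma> A M)"

definition dual_alg ::
    "('g, 'h, 'r) strsig \<Rightarrow> ('m, 'f) alg \<Rightarrow> ('m, 'g, 'h, 'r) topstr \<Rightarrow> ('x, 'g, 'h, 'r) topstr \<Rightarrow>
     ('x \<Rightarrow> 'm, 'f) alg" where
  "dual_alg \<tau> M N X = (alg_power M (points X))\<lparr>universe := str_hom \<tau> X N\<rparr>"

definition eval_alg :: "('f \<rightharpoonup> nat) \<Rightarrow> ('m, 'f) alg \<Rightarrow> ('a, 'f) alg \<Rightarrow> 'a \<Rightarrow> ('a \<Rightarrow> 'm) \<Rightarrow> 'm" where
  "eval_alg \<sigma> M A = (\<lambda>a\<in>universe A. \<lambda>u\<in>alg_hom \<sigma> A M. u a)"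

definition eval_str ::
    "('g, 'h, 'r) strsig \<Rightarrow> ('m, 'g, 'h, 'r) topstr \<Rightarrow> ('x, 'g, 'h, 'r) topstr \<Rightarrow>
     'x \<Rightarrow> ('x \<Rightarrow> 'm) \<Rightarrow> 'm" where
  "eval_str \<tau> N X = (\<lambda>x\<in>points X. \<lambda>v\<in>str_hom \<tau> X N. v x)"

text \<open>The hom-functors into \<open>M\<close> and \<open>N\<close> are dually adjoint with the evaluation maps as unit and
  counit; they form a dual equivalence iff all evaluation maps are isomorphisms. The type arguments
  \<open>'u\<close> and \<open>'x\<close> here and below say over which types the algebras and the structures range.\<close>

definition full_duality ::
    "'u itself \<Rightarrow> 'x itself \<Rightarrow> ('f \<rightharpoonup> nat) \<Rightarrow> ('m, 'f) alg \<Rightarrow>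
     ('g, 'h, 'r) strsig \<Rightarrow> ('m, 'g, 'h, 'r) topstr \<Rightarrow> bool" where
  "full_duality _ _ \<sigma> M \<tau> N \<longleftrightarrow>
     (\<forall>A :: ('u, 'f) alg. in_ISP \<sigma> M A \<longrightarrow>
        alg_iso \<sigma> (eval_alg \<sigma> M A) A (dual_alg \<tau> M N (dual_str \<sigma> M N A))) \<and>
     (\<forall>X :: ('x, 'g, 'h, 'r) topstr. in_ISP_closed \<tau> N X \<longrightarrow>
        str_iso \<tau> (eval_str \<tau> N X) X (dual_str \<sigma> M N (dual_alg \<tau> M N X)))"

definition injective_str ::
    "'x itself \<Rightarrow> ('g, 'h, 'r) strsig \<Rightarrow> ('m, 'g, 'h, 'r) topstr \<Rightarrow> bool" where
  "injective_str _ \<tau> N \<longleftrightarrow>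
     (\<forall>(X :: ('x, 'g, 'h, 'r) topstr) (Y :: ('x, 'g, 'h, 'r) topstr) f u.
        in_ISP_closed \<tau> N X \<and> in_ISP_closed \<tau> N Y \<and> str_embedding \<tau> f X Y \<and> u \<in> str_hom \<tau> X N \<longrightarrow>
        (\<exists>v \<in> str_hom \<tau> Y N. \<forall>x\<in>points X. v (f x) = u x))"

definition is_coproduct ::
    "('g, 'h, 'r) strsig \<Rightarrow> ('m, 'g, 'h, 'r) topstr \<Rightarrow> 'i set \<Rightarrow> ('i \<Rightarrow> ('x, 'g, 'h, 'r) topstr) \<Rightarrow>
     ('x, 'g, 'h, 'r) topstr \<Rightarrow> ('i \<Rightarrow> 'x \<Rightarrow> 'x) \<Rightarrow> bool" where
  "is_coproduct \<tau> N I X Z u \<longleftrightarrow> in_ISP_closed \<tau> N Z \<and> (\<forall>i\<in>I. u i \<in> str_hom \<tau> (X i) Z) \<and>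
     (\<forall>(W :: ('x, 'g, 'h, 'r) topstr) v.
        in_ISP_closed \<tau> N W \<and> (\<forall>i\<in>I. v i \<in> str_hom \<tau> (X i) W) \<longrightarrow>
        (\<exists>!w. w \<in> str_hom \<tau> Z W \<and> (\<forall>i\<in>I. \<forall>x\<in>points (X i). w (u i x) = v i x)))"

definition const_points :: "('g, 'h, 'r) strsig \<Rightarrow> ('x, 'g, 'h, 'r) topstr \<Rightarrow> 'x set" where
  "const_points \<tau> X = {tot_op X g [] | g. tot_ar \<tau> g = Some 0}"

text \<open>\<open>Z\<close> with the injections \<open>u\<close> is the direct union of the \<open>X i\<close>: the disjoint union with the
  constants amalgamated, where operations, relations and the topology are those of the pieces. The
  constants are mentioned separately in the covering conditions only for the sake of the empty
  family, whose direct union consists of the constants alone.\<close>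

definition is_direct_union ::
    "('g, 'h, 'r) strsig \<Rightarrow> 'i set \<Rightarrow> ('i \<Rightarrow> ('x, 'g, 'h, 'r) topstr) \<Rightarrow>
     ('x, 'g, 'h, 'r) topstr \<Rightarrow> ('i \<Rightarrow> 'x \<Rightarrow> 'x) \<Rightarrow> bool" where
  "is_direct_union \<tau> I X Z u \<longleftrightarrow>
     (\<forall>i\<in>I. str_embedding \<tau> (u i) (X i) Z) \<and>
     points Z = const_points \<tau> Z \<union> (\<Union>i\<in>I. u i ` points (X i)) \<and>
     (\<forall>i\<in>I. \<forall>j\<in>I. i \<noteq> j \<longrightarrow> u i ` points (X i) \<inter> u j ` points (X j) = const_points \<tau> Z) \<and>
     (\<forall>h n xs y. par_ar \<tau> h = Some n \<and> par_op Z h xs = Some y \<longrightarrow>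
        set xs \<subseteq> const_points \<tau> Z \<or> (\<exists>i\<in>I. set xs \<subseteq> u i ` points (X i))) \<and>
     (\<forall>r n xs. rel_ar \<tau> r = Some n \<and> xs \<in> rels Z r \<longrightarrow>
        set xs \<subseteq> const_points \<tau> Z \<or> (\<exists>i\<in>I. set xs \<subseteq> u i ` points (X i))) \<and>
     (\<forall>V. openin (topo Z) V \<longleftrightarrow>
        V \<subseteq> points Z \<and> (\<forall>i\<in>I. openin (topo (X i)) {x \<in> points (X i). u i x \<in> V}))"

definition coproducts_are_direct_unions ::
    "'x itself \<Rightarrow> ('g, 'h, 'r) strsig \<Rightarrow> ('m, 'g, 'h, 'r) topstr \<Rightarrow> bool" where
  "coproducts_are_direct_unions _ \<tau> N \<longleftrightarrow>
     (\<forall>(n :: nat) (X :: nat \<Rightarrow> ('x, 'g, 'h, 'r) topstr).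
        (\<forall>i\<in>{1..n}. in_ISP_closed \<tau> N (X i)) \<longrightarrow>
        (\<exists>Z u. is_coproduct \<tau> N {1..n} X Z u \<and> is_direct_union \<tau> {1..n} X Z u))"

definition logarithmic_duality ::
    "'u itself \<Rightarrow> 'x itself \<Rightarrow> ('f \<rightharpoonup> nat) \<Rightarrow> ('m, 'f) alg \<Rightarrow>
     ('g, 'h, 'r) strsig \<Rightarrow> ('m, 'g, 'h, 'r) topstr \<Rightarrow> bool" where
  "logarithmic_duality U V \<sigma> M \<tau> N \<longleftrightarrow>
     (\<forall>g n. tot_ar \<tau> g = Some n \<longrightarrow> n \<le> 1) \<and> (\<forall>h n. par_ar \<tau> h = Some n \<longrightarrow> n \<le> 1) \<and>
     full_duality U V \<sigma> M \<tau> N \<and> injective_str V \<tau> N \<and> coproducts_are_direct_unions V \<tau> N"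

type_synonym 'a poset = "'a set \<times> ('a \<Rightarrow> 'a \<Rightarrow> bool)"

definition poset_iso :: "'a poset \<Rightarrow> 'b poset \<Rightarrow> bool" where
  "poset_iso P Q \<longleftrightarrow> (\<exists>f. bij_betw f (fst P) (fst Q) \<and>
     (\<forall>x\<in>fst P. \<forall>y\<in>fst P. snd P x y \<longleftrightarrow> snd Q (f x) (f y)))"

definition dual_poset :: "'a poset \<Rightarrow> 'a poset" where
  "dual_poset P = (fst P, \<lambda>x y. snd P y x)"

definition disjoint_sum :: "'k set \<Rightarrow> ('k \<Rightarrow> 'a poset) \<Rightarrow> ('k \<times> 'a) poset" where
  "disjoint_sum K P = (SIGMA k:K. fst (P k), \<lambda>(k, x) (l, y). k = l \<and> snd (P k) x y)"

definition maximal_elements :: "'a poset \<Rightarrow> 'a set" where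
  "maximal_elements P = {x \<in> fst P. \<forall>y\<in>fst P. snd P x y \<longrightarrow> y = x}"

definition partition_lattice :: "nat \<Rightarrow> nat set set poset" where
  "partition_lattice k = ({P. partition_on {1..k} P}, refines {1..k})"

text \<open>A function on \<open>A\<^sup>n\<close> is paired with its arity, since functions of different arities have
  different domains but the same HOL type.\<close>

type_synonym ('a, 'b) multi_fun = "nat \<times> ((nat \<Rightarrow> 'a) \<Rightarrow> 'b)"

definition multi_homs ::
    "('f \<rightharpoonup> nat) \<Rightarrow> ('a, 'f) alg \<Rightarrow> ('b, 'f) alg \<Rightarrow> ('a, 'b) multi_fun set" where
  "multi_homs \<sigma> A B = {(n, f). n \<ge> 1 \<and> f \<in> alg_hom \<sigma> (alg_power A {1..n}) B}"

definition reindex :: "nat \<Rightarrow> (nat \<Rightarrow> nat) \<Rightarrow> (nat \<Rightarrow> 'a) \<Rightarrow> nat \<Rightarrow> 'a" where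
  "reindex n t a = (\<lambda>i\<in>{1..n}. a (t i))"

fun minor_le :: "('a, 'f) alg \<Rightarrow> ('a, 'b) multi_fun \<Rightarrow> ('a, 'b) multi_fun \<Rightarrow> bool" where
  "minor_le A (m, g) (n, f) \<longleftrightarrow>
     (\<exists>t \<in> {1..n} \<rightarrow> {1..m}. \<forall>a \<in> {1..m} \<rightarrow>\<^sub>E universe A. g a = f (reindex n t a))"

definition minor_equiv ::
    "('f \<rightharpoonup> nat) \<Rightarrow> ('a, 'f) alg \<Rightarrow> ('b, 'f) alg \<Rightarrow> ('a, 'b) multi_fun rel" where
  "minor_equiv \<sigma> A B = {(p, q). p \<in> multi_homs \<sigma> A B \<and> q \<in> multi_homs \<sigma> A B \<and>
     minor_le A p q \<and> minor_le A q p}"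

definition minor_poset ::
    "('f \<rightharpoonup> nat) \<Rightarrow> ('a, 'f) alg \<Rightarrow> ('b, 'f) alg \<Rightarrow> ('a, 'b) multi_fun set poset" where
  "minor_poset \<sigma> A B =
     (multi_homs \<sigma> A B // minor_equiv \<sigma> A B, \<lambda>C D. \<exists>p\<in>C. \<exists>q\<in>D. minor_le A p q)"

fun ess :: "('a, 'f) alg \<Rightarrow> ('a, 'b) multi_fun \<Rightarrow> nat" where
  "ess A (n, f) = card {i \<in> {1..n}.
     \<exists>a \<in> {1..n} \<rightarrow>\<^sub>E universe A. \<exists>b \<in> {1..n} \<rightarrow>\<^sub>E universe A.
       (\<forall>j \<in> {1..n} - {i}. a j = b j) \<and> f a \<noteq> f b}"

text \<open>Equivalent functions have equally many essential arguments; this is their common number.\<close>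

definition class_ess :: "('a, 'f) alg \<Rightarrow> ('a, 'b) multi_fun set \<Rightarrow> nat" where
  "class_ess A C = the_elem (ess A ` C)"

end

theory Submission
  imports Defs
begin

text \<open>Every homomorphism from a power \<open>A\<^sup>n\<close> to \<open>M\<close> factors through a projection, because the dual of
  \<open>A\<^sup>n\<close> is the coproduct of \<open>n\<close> copies of the dual of \<open>A\<close> and this coproduct is a direct union. Hence a
  homomorphism \<open>f\<close> from \<open>A\<^sup>n\<close> to \<open>B\<close> is determined by its diagonal \<open>\<delta>\<close> and by the map that sends each
  homomorphism \<open>y\<close> from \<open>B\<close> to \<open>M\<close> with \<open>y \<circ> \<delta>\<close> not constant to the argument that \<open>y \<circ> f\<close> depends on.
  The essential arguments are the values of this map, and minors correspond to equal diagonals and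
  coarser kernels. The kernels that occur over a fixed diagonal are closed under coarsening and, by the
  duality for \<open>B\<close>, under common refinement. If the numbers of essential arguments are bounded, there is
  a finest one over each diagonal, and its coarsenings form the dual of a partition lattice.\<close>

section \<open>Topological structures\<close>

text \<open>Call the homomorphisms from \<open>B\<close> to \<open>M\<close> characters. A character
  that is constant on the diagonal of f is constant on all values of f, so every argument serves it
  and it says nothing about f; for any other character the argument is unique. This is why kernels
  are compared only over the moving characters, a set that depends on the diagonal alone.

  The critical step is the common refinement, whose values must be found inside \<open>B\<close>.
  They are obtained as morphisms from the dual of \<open>B\<close> to \<open>N\<close>, so the
  prescribed values have to preserve operations, relations and topology. Operations are at most
  unary, and their value reads the same argument as the character they are applied to. Every related
  tuple of a direct union lies in one piece, so related characters share an argument. Continuity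
  holds because a tuple has finitely many entries.

  The duality is assumed for structures on one fixed type, while duals live on function types; hence
  the transport of structures along injections.\<close>

lemma openin_agree_on_finite:
  assumes "finite F" "F \<subseteq> I" "y \<in> I \<rightarrow>\<^sub>E U"
  shows "openin (product_topology (\<lambda>_. discrete_topology U) I) {z \<in> I \<rightarrow>\<^sub>E U. \<forall>i\<in>F. z i = y i}"
proof -
  let ?S = "\<lambda>i. if i \<in> F then {y i} else U"
  have eq: "{z \<in> I \<rightarrow>\<^sub>E U. \<forall>i\<in>F. z i = y i} = PiE I ?S"
    using assms by (auto simp: PiE_iff extensional_def split: if_splits)
  have "{i \<in> I. ?S i \<noteq> U} \<subseteq> F" by auto
  then have "finite {i \<in> I. ?S i \<noteq> U}" using assms(1) finite_subset by blast
  then show ?thesis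
    unfolding eq openin_PiE_gen using assms by (auto simp: PiE_iff)
qed

lemma list_in_imageE:
  assumes "set xs \<subseteq> f ` P"
  obtains ys where "set ys \<subseteq> P" "xs = map f ys"
proof
  show "set (map (inv_into P f) xs) \<subseteq> P" using assms by (auto simp: inv_into_into subset_iff)
  show "xs = map f (map (inv_into P f) xs)"
    using assms by (simp add: map_idI f_inv_into_f subset_iff)
qed

lemma str_homD:
  assumes "f \<in> str_hom \<tau> X Y"
  shows "f \<in> extensional (points X)" "continuous_map (topo X) (topo Y) f"
    "\<And>x. x \<in> points X \<Longrightarrow> f x \<in> points Y"
    "\<And>g n xs. \<lbrakk>tot_ar \<tau> g = Some n; length xs = n; set xs \<subseteq> points X\<rbrakk> \<Longrightarrow>
        f (tot_op X g xs) = tot_op Y g (map f xs)"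
    "\<And>h n xs y. \<lbrakk>par_ar \<tau> h = Some n; par_op X h xs = Some y\<rbrakk> \<Longrightarrow> par_op Y h (map f xs) = Some (f y)"
    "\<And>r n xs. \<lbrakk>rel_ar \<tau> r = Some n; xs \<in> rels X r\<rbrakk> \<Longrightarrow> map f xs \<in> rels Y r"
proof -
  show cont: "continuous_map (topo X) (topo Y) f" using assms by (simp add: str_hom_def)
  show "f x \<in> points Y" if "x \<in> points X" for x
    using continuous_map_image_subset_topspace[OF cont] that by blast
qed (use assms in \<open>simp_all add: str_hom_def\<close>)

lemma str_homI:
  assumes "f \<in> extensional (points X)" "continuous_map (topo X) (topo Y) f"
    "\<And>g n xs. \<lbrakk>tot_ar \<tau> g = Some n; length xs = n; set xs \<subseteq> points X\<rbrakk> \<Longrightarrow>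
        f (tot_op X g xs) = tot_op Y g (map f xs)"
    "\<And>h n xs y. \<lbrakk>par_ar \<tau> h = Some n; par_op X h xs = Some y\<rbrakk> \<Longrightarrow> par_op Y h (map f xs) = Some (f y)"
    "\<And>r n xs. \<lbrakk>rel_ar \<tau> r = Some n; xs \<in> rels X r\<rbrakk> \<Longrightarrow> map f xs \<in> rels Y r"
  shows "f \<in> str_hom \<tau> X Y"
  using assms by (simp add: str_hom_def)

lemma is_topstrD:
  assumes "is_topstr \<tau> X"
  shows "\<And>g n xs. \<lbrakk>tot_ar \<tau> g = Some n; length xs = n; set xs \<subseteq> points X\<rbrakk> \<Longrightarrow> tot_op X g xs \<in> points X"
    "\<And>h n xs y. \<lbrakk>par_ar \<tau> h = Some n; par_op X h xs = Some y\<rbrakk> \<Longrightarrow>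
        length xs = n \<and> set xs \<subseteq> points X \<and> y \<in> points X"
    "\<And>r n xs. \<lbrakk>rel_ar \<tau> r = Some n; xs \<in> rels X r\<rbrakk> \<Longrightarrow> length xs = n \<and> set xs \<subseteq> points X"
  using assms unfolding is_topstr_def by blast+

lemma str_hom_compose:
  assumes X: "is_topstr \<tau> X" and f: "f \<in> str_hom \<tau> X Y" and g: "g \<in> str_hom \<tau> Y Z"
  shows "(\<lambda>x\<in>points X. g (f x)) \<in> str_hom \<tau> X Z"
proof -
  have m: "map (\<lambda>x\<in>points X. g (f x)) xs = map g (map f xs)" if "set xs \<subseteq> points X" for xs
    using that by (auto simp: subset_iff)
  show ?thesis
  proof (rule str_homI)
    show "continuous_map (topo X) (topo Z) (\<lambda>x\<in>points X. g (f x))"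
      using continuous_map_compose[OF str_homD(2)[OF f] str_homD(2)[OF g]]
      by (rule continuous_map_eq) auto
  next
    fix o' n xs assume a: "tot_ar \<tau> o' = Some n" "length xs = n" "set xs \<subseteq> points X"
    then have "set (map f xs) \<subseteq> points Y" using str_homD(3)[OF f] by auto
    then show "(\<lambda>x\<in>points X. g (f x)) (tot_op X o' xs) = tot_op Z o' (map (\<lambda>x\<in>points X. g (f x)) xs)"
      unfolding m[OF a(3)] using a is_topstrD(1)[OF X a] str_homD(4)[OF f a] str_homD(4)[OF g a(1), of "map f xs"]
      by simp
  next
    fix h n xs y assume a: "par_ar \<tau> h = Some n" "par_op X h xs = Some y"
    then have b: "set xs \<subseteq> points X" "y \<in> points X" using is_topstrD(2)[OF X] by blast+
    then show "par_op Z h (map (\<lambda>x\<in>points X. g (f x)) xs) = Some ((\<lambda>x\<in>points X. g (f x)) y)"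
      unfolding m[OF b(1)] using str_homD(5)[OF g a(1) str_homD(5)[OF f a]] by simp
  next
    fix r n xs assume a: "rel_ar \<tau> r = Some n" "xs \<in> rels X r"
    then have b: "set xs \<subseteq> points X" using is_topstrD(3)[OF X] by blast
    show "map (\<lambda>x\<in>points X. g (f x)) xs \<in> rels Z r"
      unfolding m[OF b] using str_homD(6)[OF g a(1) str_homD(6)[OF f a]] .
  qed simp
qed

lemma points_str_restrict: "points (str_restrict X S) = points X \<inter> S"
  by (simp add: str_restrict_def)

lemma points_str_power: "points (str_power N I) = (\<Pi>\<^sub>E i\<in>I. points N)"
  by (simp add: str_power_def)

text \<open>The family of evaluations at the elements of \<open>I\<close> embeds \<open>X\<close> as a closed substructure of a power,
  because a continuous injection of a compact space into a Hausdorff space is a closed embedding.\<close>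

lemma in_ISP_closedI:
  fixes X :: "('x, 'g, 'h, 'r) topstr" and N :: "('m, 'g, 'h, 'r) topstr"
    and I :: "('x \<Rightarrow> 'm) set"
  assumes X: "is_topstr \<tau> X" and cpt: "compact_space (topo X)" and haus: "Hausdorff_space (topo N)"
    and I: "I \<noteq> {}" "I \<subseteq> str_hom \<tau> X N"
    and sep: "\<And>x y. \<lbrakk>x \<in> points X; y \<in> points X; \<forall>i\<in>I. i x = i y\<rbrakk> \<Longrightarrow> x = y"
    and par: "\<And>h n xs. \<lbrakk>par_ar \<tau> h = Some n; set xs \<subseteq> points X; \<forall>i\<in>I. par_op N h (map i xs) \<noteq> None\<rbrakk>
        \<Longrightarrow> par_op X h xs \<noteq> None"
    and rel: "\<And>r n xs. \<lbrakk>rel_ar \<tau> r = Some n; set xs \<subseteq> points X; \<forall>i\<in>I. map i xs \<in> rels N r\<rbrakk>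
        \<Longrightarrow> xs \<in> rels X r"
  shows "in_ISP_closed \<tau> N X"
proof -
  define F where "F = (\<lambda>x\<in>points X. \<lambda>i\<in>I. i x)"
  define S where "S = F ` points X"
  define G where "G = (\<lambda>s\<in>S. inv_into (points X) F s)"
  let ?P = "str_power N I"
  let ?R = "str_restrict ?P S"
  have Fi: "F x i = i x" if "x \<in> points X" "i \<in> I" for x i using that by (simp add: F_def)
  have inj: "inj_on F (points X)"
  proof (rule inj_onI)
    fix x y assume a: "x \<in> points X" "y \<in> points X" "F x = F y"
    have "i x = i y" if "i \<in> I" for i using Fi[of x i] Fi[of y i] a that by simp
    then show "x = y" using sep a by blast
  qed
  have GF: "G (F x) = x" if "x \<in> points X" for x using that inj by (simp add: G_def S_def)
  have FG: "F (G s) = s" if "s \<in> S" for s using that GF by (auto simp: S_def)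
  have Fpow: "F x \<in> (\<Pi>\<^sub>E i\<in>I. points N)" if "x \<in> points X" for x
    using that I(2) str_homD(3)[of _ \<tau> X N x] by (auto simp: F_def)
  have contP: "continuous_map (topo X) (topo ?P) F"
  proof -
    have "continuous_map (topo X) (topo N) (\<lambda>x. F x i)" if "i \<in> I" for i
    proof -
      have "i \<in> str_hom \<tau> X N" using I(2) that by blast
      then show ?thesis by (rule continuous_map_eq[OF str_homD(2)]) (simp add: Fi that)
    qed
    then show ?thesis unfolding str_power_def
      by (auto simp: continuous_map_componentwise F_def extensional_def)
  qed
  have hausP: "Hausdorff_space (topo ?P)"
    using haus by (simp add: str_power_def Hausdorff_space_product_topology)
  have SP: "S \<subseteq> points ?P" using Fpow by (auto simp: S_def points_str_power)
  have clS: "closedin (topo ?P) S"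
    unfolding S_def
    using compactin_imp_closedin[OF hausP] image_compactin[OF _ contP] cpt by (simp add: compact_space_def)
  have pR: "points ?R = S" using SP by (auto simp: points_str_restrict)
  have mF: "map (\<lambda>x. x i) (map F ys) = map i ys" if "set ys \<subseteq> points X" "i \<in> I" for i ys
    using that Fi by (auto simp: subset_iff)
  have setF: "set (map F ys) \<subseteq> (\<Pi>\<^sub>E i\<in>I. points N)" if "set ys \<subseteq> points X" for ys
    using that Fpow by auto
  have powtot: "tot_op ?P g (map F ys) = (\<lambda>i\<in>I. tot_op N g (map i ys))" if "set ys \<subseteq> points X" for g ys
    unfolding str_power_def topstr.simps by (rule restrict_ext) (simp only: mF[OF that])
  have powpar: "par_op ?P h (map F ys) = (if \<forall>i\<in>I. par_op N h (map i ys) \<noteq> None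
      then Some (\<lambda>i\<in>I. the (par_op N h (map i ys))) else None)" if "set ys \<subseteq> points X" for h ys
  proof -
    have "(\<lambda>i\<in>I. the (par_op N h (map (\<lambda>x. x i) (map F ys)))) = (\<lambda>i\<in>I. the (par_op N h (map i ys)))"
      by (rule restrict_ext) (simp only: mF[OF that])
    then show ?thesis
      unfolding str_power_def topstr.simps using setF[OF that]
      by (simp only: mF[OF that] simp_thms cong: ball_cong)
  qed
  have powrel: "map F ys \<in> rels ?P r \<longleftrightarrow> (\<forall>i\<in>I. map i ys \<in> rels N r)" if "set ys \<subseteq> points X" for r ys
    unfolding str_power_def topstr.simps mem_Collect_eq using setF[OF that]
    by (simp only: mF[OF that] simp_thms cong: ball_cong)
  have tot: "tot_op ?P g (map F ys) = F (tot_op X g ys)"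
    if a: "tot_ar \<tau> g = Some n" "length ys = n" "set ys \<subseteq> points X" for g n ys
  proof -
    have "tot_op N g (map i ys) = i (tot_op X g ys)" if "i \<in> I" for i
      using str_homD(4)[of i \<tau> X N, OF _ a] that I(2) by auto
    then show ?thesis
      unfolding powtot[OF a(3)] using is_topstrD(1)[OF X a] by (simp add: F_def cong: restrict_cong)
  qed
  have parF: "par_op ?P h (map F ys) = Some (F z)"
    if a: "par_ar \<tau> h = Some n" "par_op X h ys = Some z" for h n ys z
  proof -
    have b: "set ys \<subseteq> points X" "z \<in> points X" using is_topstrD(2)[OF X a] by auto
    have "par_op N h (map i ys) = Some (i z)" if "i \<in> I" for i
      using str_homD(5)[of i \<tau> X N, OF _ a] that I(2) by auto
    then show ?thesis
      unfolding powpar[OF b(1)] using b(2) by (simp add: F_def cong: restrict_cong)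
  qed
  \<comment> \<open>A substructure of a power carries the full restrictions of the partial
    operations and relations, so the embedding must reflect definedness. This is where
    \<open>par\<close> enters; \<open>rel\<close> does the same for relations below.\<close>
  have parP: "\<exists>z. par_op X h ys = Some z \<and> y = F z"
    if a: "par_ar \<tau> h = Some n" "par_op ?P h (map F ys) = Some y" "set ys \<subseteq> points X" for h n ys y
  proof -
    have "\<forall>i\<in>I. par_op N h (map i ys) \<noteq> None"
      using a(2) unfolding powpar[OF a(3)] by (simp split: if_splits)
    then obtain z where z: "par_op X h ys = Some z" using par[OF a(1,3)] by blast
    then show ?thesis using parF[OF a(1) z] a(2) by auto
  qed
  have closed: "closed_substr \<tau> S ?P"
    unfolding closed_substr_def
  proof (intro conjI allI impI clS; elim conjE)
    fix g n xs assume a: "tot_ar \<tau> g = Some n" "length xs = n" "set xs \<subseteq> S"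
    then obtain ys where ys: "set ys \<subseteq> points X" "xs = map F ys" using list_in_imageE[of xs F "points X"] unfolding S_def by blast
    then show "tot_op ?P g xs \<in> S"
      using tot[OF a(1) _ ys(1)] is_topstrD(1)[OF X a(1) _ ys(1)] a(2) by (auto simp: S_def)
  next
    fix h n xs y assume a: "par_ar \<tau> h = Some n" "set xs \<subseteq> S" "par_op ?P h xs = Some y"
    then obtain ys where ys: "set ys \<subseteq> points X" "xs = map F ys" using list_in_imageE[of xs F "points X"] unfolding S_def by blast
    then show "y \<in> S"
      using parP[OF a(1) _ ys(1)] a(3) is_topstrD(2)[OF X a(1)] by (fastforce simp: S_def)
  qed
  have contR: "continuous_map (topo X) (topo ?R) F"
    using contP by (auto simp: str_restrict_def continuous_map_in_subtopology S_def)
  have homeo: "homeomorphic_map (topo X) (topo ?R) F"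
    using contR cpt hausP pR inj
    by (intro continuous_imp_homeomorphic_map) (auto simp: str_restrict_def Hausdorff_space_subtopology S_def)
  have contG: "continuous_map (topo ?R) (topo X) G"
  proof -
    obtain G' where "homeomorphic_maps (topo X) (topo ?R) F G'" using homeo homeomorphic_map_maps by blast
    then show ?thesis
      using pR GF unfolding homeomorphic_maps_def
      by (auto intro!: continuous_map_eq[where f=G'] simp: S_def)
  qed
  have Fhom: "F \<in> str_hom \<tau> X ?R"
  proof (rule str_homI)
    fix h n xs y assume a: "par_ar \<tau> h = Some n" "par_op X h xs = Some y"
    then show "par_op ?R h (map F xs) = Some (F y)"
      using parF[OF a] is_topstrD(2)[OF X a] by (auto simp: str_restrict_def S_def)
  next
    fix r n xs assume a: "rel_ar \<tau> r = Some n" "xs \<in> rels X r"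
    then have b: "set xs \<subseteq> points X" using is_topstrD(3)[OF X] by auto
    then show "map F xs \<in> rels ?R r"
      using str_homD(6)[OF _ a] I(2) powrel[OF b, of r] unfolding str_restrict_def S_def by auto
  next
    fix g n xs assume a: "tot_ar \<tau> g = Some n" "length xs = n" "set xs \<subseteq> points X"
    then show "F (tot_op X g xs) = tot_op ?R g (map F xs)" using tot[OF a] by (simp add: str_restrict_def)
  qed (use contR in \<open>simp_all add: F_def\<close>)
  have Ghom: "G \<in> str_hom \<tau> ?R X"
  proof (rule str_homI)
    show "G \<in> extensional (points ?R)" by (simp add: pR G_def)
    show "continuous_map (topo ?R) (topo X) G" by (rule contG)
  next
    fix g n xs assume a: "tot_ar \<tau> g = Some n" "length xs = n" "set xs \<subseteq> points ?R"
    then obtain ys where ys: "set ys \<subseteq> points X" "xs = map F ys"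
      using list_in_imageE[of xs F "points X"] pR S_def by blast
    have "map G xs = ys" using ys GF by (simp add: map_idI subset_iff)
    then show "G (tot_op ?R g xs) = tot_op X g (map G xs)"
      using tot[OF a(1) _ ys(1)] is_topstrD(1)[OF X a(1) _ ys(1)] a(2) ys(2) GF
      by (auto simp: str_restrict_def)
  next
    fix h n xs y assume a: "par_ar \<tau> h = Some n" "par_op ?R h xs = Some y"
    then have "set xs \<subseteq> S" and P: "par_op ?P h xs = Some y" by (auto simp: str_restrict_def split: if_splits)
    then obtain ys where ys: "set ys \<subseteq> points X" "xs = map F ys" using list_in_imageE[of xs F "points X"] unfolding S_def by blast
    then obtain z where z: "par_op X h ys = Some z" "y = F z" using parP[OF a(1) _ ys(1)] P by auto
    have "map G xs = ys" using ys GF by (simp add: map_idI subset_iff)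
    then show "par_op X h (map G xs) = Some (G y)"
      using z GF is_topstrD(2)[OF X a(1) z(1)] by auto
  next
    fix r n xs assume a: "rel_ar \<tau> r = Some n" "xs \<in> rels ?R r"
    then have "set xs \<subseteq> S" and P: "xs \<in> rels ?P r" by (auto simp: str_restrict_def)
    then obtain ys where ys: "set ys \<subseteq> points X" "xs = map F ys" using list_in_imageE[of xs F "points X"] unfolding S_def by blast
    have "map G xs = ys" using ys GF by (simp add: map_idI subset_iff)
    moreover have "\<forall>i\<in>I. map i ys \<in> rels N r"
      using P ys(2) powrel[OF ys(1)] by blast
    ultimately show "map G xs \<in> rels X r" using rel[OF a(1) ys(1)] by simp
  qed
  have "str_iso \<tau> F X ?R"
    unfolding str_iso_def using Fhom Ghom GF FG by (auto simp: pR)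
  then show ?thesis
    unfolding in_ISP_closed_def using X I(1) closed by blast
qed

section \<open>Transport of structures along injections\<close>

text \<open>The duality will be assumed on the type
  \<open>nat \<times> ('u \<Rightarrow> 'm)\<close>, whereas the dual of \<open>A\<close> and
  \<open>N\<close> live on other types; \<open>c\<close> carries them over. As \<open>c\<close> will
  be injective on its whole type, \<open>inv c\<close> is a left inverse, and only arguments in the
  image of the points matter.\<close>

definition str_copy :: "('y \<Rightarrow> 'x) \<Rightarrow> ('y, 'g, 'h, 'r) topstr \<Rightarrow> ('x, 'g, 'h, 'r) topstr" where
  "str_copy c X =
     \<lparr> topo = pullback_topology (c ` points X) (inv c) (topo X),
       tot_op = (\<lambda>g xs. c (tot_op X g (map (inv c) xs))),
       par_op = (\<lambda>h xs. if set xs \<subseteq> c ` points X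
          then map_option c (par_op X h (map (inv c) xs)) else None),
       rels = (\<lambda>r. {xs. set xs \<subseteq> c ` points X \<and> map (inv c) xs \<in> rels X r}) \<rparr>"

lemma points_str_copy: "inj c \<Longrightarrow> points (str_copy c X) = c ` points X"
  by (auto simp: str_copy_def topspace_pullback_topology)

lemma map_inv_copy: "inj c \<Longrightarrow> map (inv c) (map c xs) = xs"
  by (simp add: o_def)

lemma is_topstr_str_copy:
  assumes c: "inj c" and X: "is_topstr \<tau> X"
  shows "is_topstr \<tau> (str_copy c X)"
  unfolding is_topstr_def points_str_copy[OF c]
proof (intro conjI allI impI; elim conjE)
  fix g n xs assume a: "tot_ar \<tau> g = Some n" "length xs = n" "set xs \<subseteq> c ` points X"
  then obtain ys where ys: "set ys \<subseteq> points X" "xs = map c ys" by (auto elim: list_in_imageE)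
  then show "tot_op (str_copy c X) g xs \<in> c ` points X"
    using is_topstrD(1)[OF X a(1) _ ys(1)] a(2) map_inv_copy[OF c] by (auto simp: str_copy_def)
next
  fix h n xs y assume a: "par_ar \<tau> h = Some n" "par_op (str_copy c X) h xs = Some y"
  then obtain z where "set xs \<subseteq> c ` points X" "par_op X h (map (inv c) xs) = Some z" "y = c z"
    by (auto simp: str_copy_def split: if_splits)
  then show "length xs = n" "set xs \<subseteq> c ` points X" "y \<in> c ` points X"
    using is_topstrD(2)[OF X a(1)] by fastforce+
next
  fix r n xs assume a: "rel_ar \<tau> r = Some n" "xs \<in> rels (str_copy c X) r"
  then show "length xs = n" "set xs \<subseteq> c ` points X"
    using is_topstrD(3)[OF X a(1)] by (fastforce simp: str_copy_def)+
qed

lemma continuous_map_inv_str_copy: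
  "continuous_map (topo (str_copy c X)) (topo X) (inv c)"
  using continuous_map_pullback[OF continuous_map_id, of "c ` points X" "inv c" "topo X"]
  by (simp add: str_copy_def)

text \<open>With \<open>copy_inv_str_hom\<close> this gives mutually inverse morphisms; the
  restrictions to the points are there because \<open>str_hom\<close> contains extensional functions
  only.\<close>

lemma copy_map_str_hom:
  assumes c: "inj c" and X: "is_topstr \<tau> X"
  shows "(\<lambda>x\<in>points X. c x) \<in> str_hom \<tau> X (str_copy c X)" (is "?f \<in> _")
proof (rule str_homI)
  have m: "map ?f xs = map c xs" if "set xs \<subseteq> points X" for xs using that by (auto simp: subset_iff)
  show "continuous_map (topo X) (topo (str_copy c X)) ?f"
    unfolding str_copy_def topstr.simps
    by (intro continuous_map_pullback' continuous_map_eq[OF continuous_map_id]) (use c in auto)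
  show "?f (tot_op X g xs) = tot_op (str_copy c X) g (map ?f xs)"
    if a: "tot_ar \<tau> g = Some n" "length xs = n" "set xs \<subseteq> points X" for g n xs
    using is_topstrD(1)[OF X a] by (simp add: str_copy_def m[OF a(3)] map_inv_copy[OF c] del: map_map)
  show "par_op (str_copy c X) h (map ?f xs) = Some (?f y)"
    if a: "par_ar \<tau> h = Some n" "par_op X h xs = Some y" for h n xs y
  proof -
    have b: "set xs \<subseteq> points X" "y \<in> points X" using is_topstrD(2)[OF X a] by blast+
    then show ?thesis
      unfolding m[OF b(1)] using a(2) by (auto simp: str_copy_def map_inv_copy[OF c] simp del: map_map)
  qed
  show "map ?f xs \<in> rels (str_copy c X) r"
    if a: "rel_ar \<tau> r = Some n" "xs \<in> rels X r" for r n xs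
  proof -
    have b: "set xs \<subseteq> points X" using is_topstrD(3)[OF X a] by blast
    then show ?thesis
      unfolding m[OF b] using a(2) by (auto simp: str_copy_def map_inv_copy[OF c] simp del: map_map)
  qed
qed simp

lemma copy_inv_str_hom:
  assumes c: "inj c" and X: "is_topstr \<tau> X"
  shows "(\<lambda>x\<in>c ` points X. inv c x) \<in> str_hom \<tau> (str_copy c X) X" (is "?f \<in> _")
proof (rule str_homI)
  have m: "map ?f (map c ys) = ys" if "set ys \<subseteq> points X" for ys
    using that c by (auto intro!: map_idI simp: subset_iff)
  note p = points_str_copy[OF c, of X]
  show "?f \<in> extensional (points (str_copy c X))" by (simp add: p)
  show "continuous_map (topo (str_copy c X)) (topo X) ?f"
    by (rule continuous_map_eq[OF continuous_map_inv_str_copy]) (simp add: p)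
  show "?f (tot_op (str_copy c X) g xs) = tot_op X g (map ?f xs)"
    if a: "tot_ar \<tau> g = Some n" "length xs = n" "set xs \<subseteq> points (str_copy c X)" for g n xs
  proof -
    obtain ys where ys: "set ys \<subseteq> points X" "xs = map c ys" using a(3) p by (auto elim: list_in_imageE)
    then show ?thesis
      using is_topstrD(1)[OF X a(1) _ ys(1)] a(2) m[OF ys(1)] map_inv_copy[OF c, of ys] c
      by (auto simp: str_copy_def)
  qed
  show "par_op X h (map ?f xs) = Some (?f y)"
    if a: "par_ar \<tau> h = Some n" "par_op (str_copy c X) h xs = Some y" for h n xs y
  proof -
    obtain ys where ys: "set ys \<subseteq> points X" "xs = map c ys"
      using is_topstrD(2)[OF is_topstr_str_copy[OF c X] a] p by (auto elim: list_in_imageE)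
    obtain z where z: "par_op X h ys = Some z" "y = c z"
      using a(2) ys map_inv_copy[OF c, of ys] by (auto simp: str_copy_def split: if_splits)
    then show ?thesis
      using m[OF ys(1)] ys(2) is_topstrD(2)[OF X a(1) z(1)] c by auto
  qed
  show "map ?f xs \<in> rels X r"
    if a: "rel_ar \<tau> r = Some n" "xs \<in> rels (str_copy c X) r" for r n xs
  proof -
    obtain ys where ys: "set ys \<subseteq> points X" "xs = map c ys"
      using is_topstrD(3)[OF is_topstr_str_copy[OF c X] a] p by (auto elim: list_in_imageE)
    then show ?thesis
      using m[OF ys(1)] map_inv_copy[OF c, of ys] a(2) by (auto simp: str_copy_def)
  qed
qed

lemma compact_space_str_copy:
  assumes "inj c" "is_topstr \<tau> X" "compact_space (topo X)"
  shows "compact_space (topo (str_copy c X))"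
  using image_compactin[of "topo X" "points X", OF _ str_homD(2)[OF copy_map_str_hom[OF assms(1,2)]]] assms(3)
  by (simp add: compact_space_def points_str_copy[OF assms(1)] image_restrict_eq)

text \<open>The index set in \<open>in_ISP_closed\<close> consists of functions on the type of the
  carrier, so it changes with the copy: each index \<open>i\<close> is replaced by its composite
  with \<open>inv c\<close> before the embedding criterion is applied.\<close>

lemma in_ISP_closed_str_copyI:
  fixes X :: "('y, 'g, 'h, 'r) topstr" and N :: "('m, 'g, 'h, 'r) topstr"
    and I :: "('y \<Rightarrow> 'm) set" and c :: "'y \<Rightarrow> 'x"
  assumes c: "inj c" and X: "is_topstr \<tau> X" and cpt: "compact_space (topo X)"
    and haus: "Hausdorff_space (topo N)"
    and I: "I \<noteq> {}" "I \<subseteq> str_hom \<tau> X N"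
    and sep: "\<And>x y. \<lbrakk>x \<in> points X; y \<in> points X; \<forall>i\<in>I. i x = i y\<rbrakk> \<Longrightarrow> x = y"
    and par: "\<And>h n xs. \<lbrakk>par_ar \<tau> h = Some n; set xs \<subseteq> points X; \<forall>i\<in>I. par_op N h (map i xs) \<noteq> None\<rbrakk>
        \<Longrightarrow> par_op X h xs \<noteq> None"
    and rel: "\<And>r n xs. \<lbrakk>rel_ar \<tau> r = Some n; set xs \<subseteq> points X; \<forall>i\<in>I. map i xs \<in> rels N r\<rbrakk>
        \<Longrightarrow> xs \<in> rels X r"
  shows "in_ISP_closed \<tau> N (str_copy c X)"
proof -
  let ?e = "\<lambda>i. \<lambda>p\<in>c ` points X. i (inv c p)"
  note p = points_str_copy[OF c, of X]
  have e: "?e i (c x) = i x" if "x \<in> points X" for i x using that c by simp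
  have me: "map (?e i) (map c ys) = map i ys" if "set ys \<subseteq> points X" for i ys
    using that c by (simp add: subset_iff)
  show ?thesis
  proof (rule in_ISP_closedI[where I = "?e ` I"])
    show "is_topstr \<tau> (str_copy c X)" by (rule is_topstr_str_copy[OF c X])
    show "compact_space (topo (str_copy c X))" by (rule compact_space_str_copy[OF c X cpt])
    show "?e ` I \<noteq> {}" using I(1) by simp
    show "?e ` I \<subseteq> str_hom \<tau> (str_copy c X) N"
    proof (rule image_subsetI)
      fix i assume "i \<in> I"
      then have "i \<in> str_hom \<tau> X N" using I(2) by blast
      then have "(\<lambda>x\<in>points (str_copy c X). i ((\<lambda>x\<in>c ` points X. inv c x) x)) \<in> str_hom \<tau> (str_copy c X) N"
        by (rule str_hom_compose[OF is_topstr_str_copy[OF c X] copy_inv_str_hom[OF c X]])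
      moreover have "(\<lambda>x\<in>points (str_copy c X). i ((\<lambda>x\<in>c ` points X. inv c x) x)) = ?e i"
        by (auto simp: p)
      ultimately show "?e i \<in> str_hom \<tau> (str_copy c X) N" by simp
    qed
    show "x = y" if a: "x \<in> points (str_copy c X)" "y \<in> points (str_copy c X)" "\<forall>j\<in>?e ` I. j x = j y" for x y
    proof -
      obtain x' y' where xy: "x = c x'" "y = c y'" "x' \<in> points X" "y' \<in> points X" using a(1,2) p by auto
      have "i x' = i y'" if "i \<in> I" for i
      proof -
        have "?e i x = ?e i y" using a(3) that by blast
        then show ?thesis unfolding xy(1,2) e[OF xy(3)] e[OF xy(4)] .
      qed
      then show ?thesis using sep[OF xy(3,4)] xy(1,2) by blast
    qed
    show "par_op (str_copy c X) h xs \<noteq> None"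
      if a: "par_ar \<tau> h = Some n" "set xs \<subseteq> points (str_copy c X)"
        "\<forall>j\<in>?e ` I. par_op N h (map j xs) \<noteq> None" for h n xs
    proof -
      obtain ys where ys: "set ys \<subseteq> points X" "xs = map c ys"
        using list_in_imageE[of xs c "points X"] a(2) p by blast
      have "par_op N h (map i ys) \<noteq> None" if "i \<in> I" for i
      proof -
        have "par_op N h (map (?e i) xs) \<noteq> None" using a(3) that by blast
        then show ?thesis unfolding ys(2) me[OF ys(1)] .
      qed
      then have "par_op X h ys \<noteq> None" using par[OF a(1) ys(1)] by blast
      then show ?thesis
        using ys a(2) p by (auto simp: str_copy_def map_inv_copy[OF c] simp del: map_map)
    qed
    show "xs \<in> rels (str_copy c X) r"
      if a: "rel_ar \<tau> r = Some n" "set xs \<subseteq> points (str_copy c X)"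
        "\<forall>j\<in>?e ` I. map j xs \<in> rels N r" for r n xs
    proof -
      obtain ys where ys: "set ys \<subseteq> points X" "xs = map c ys"
        using list_in_imageE[of xs c "points X"] a(2) p by blast
      have "map i ys \<in> rels N r" if "i \<in> I" for i
      proof -
        have "map (?e i) xs \<in> rels N r" using a(3) that by blast
        then show ?thesis unfolding ys(2) me[OF ys(1)] .
      qed
      then have "ys \<in> rels X r" using rel[OF a(1) ys(1)] by blast
      then show ?thesis
        using ys a(2) p by (auto simp: str_copy_def map_inv_copy[OF c] simp del: map_map)
    qed
  qed (rule haus)
qed

section \<open>Algebras and their duals\<close>

lemma alg_homD:
  assumes "f \<in> alg_hom \<sigma> A B"
  shows "f \<in> extensional (universe A)" "\<And>a. a \<in> universe A \<Longrightarrow> f a \<in> universe B"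
    "\<And>s n xs. \<lbrakk>\<sigma> s = Some n; length xs = n; set xs \<subseteq> universe A\<rbrakk> \<Longrightarrow> f (oper A s xs) = oper B s (map f xs)"
  using assms by (auto simp: alg_hom_def PiE_iff)

lemma alg_homI:
  assumes "f \<in> extensional (universe A)" "\<And>a. a \<in> universe A \<Longrightarrow> f a \<in> universe B"
    "\<And>s n xs. \<lbrakk>\<sigma> s = Some n; length xs = n; set xs \<subseteq> universe A\<rbrakk> \<Longrightarrow> f (oper A s xs) = oper B s (map f xs)"
  shows "f \<in> alg_hom \<sigma> A B"
  using assms by (auto simp: alg_hom_def PiE_iff)

lemma is_algebraD:
  assumes "is_algebra \<sigma> A"
  shows "universe A \<noteq> {}"
    "\<And>s n xs. \<lbrakk>\<sigma> s = Some n; length xs = n; set xs \<subseteq> universe A\<rbrakk> \<Longrightarrow> oper A s xs \<in> universe A"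
  using assms by (auto simp: is_algebra_def subuniverse_def)

lemma alg_hom_compose:
  assumes A: "is_algebra \<sigma> A" and f: "f \<in> alg_hom \<sigma> A B" and g: "g \<in> alg_hom \<sigma> B C"
  shows "(\<lambda>x\<in>universe A. g (f x)) \<in> alg_hom \<sigma> A C"
proof (rule alg_homI)
  fix s n xs assume a: "\<sigma> s = Some n" "length xs = n" "set xs \<subseteq> universe A"
  have b: "set (map f xs) \<subseteq> universe B" using alg_homD(2)[OF f] a(3) by auto
  have m: "map (\<lambda>x\<in>universe A. g (f x)) xs = map g (map f xs)" using a(3) by (simp add: subset_iff)
  show "(\<lambda>x\<in>universe A. g (f x)) (oper A s xs) = oper C s (map (\<lambda>x\<in>universe A. g (f x)) xs)"
    unfolding m using is_algebraD(2)[OF A a] alg_homD(3)[OF f a] alg_homD(3)[OF g a(1) _ b] a(2) by simp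
qed (use alg_homD(2)[OF f] alg_homD(2)[OF g] in auto)

text \<open>Graphs of operations are written with lists, while \<open>algebraic_rel\<close> refers
  to tuples as functions; this brings the closure under coordinatewise operations back to
  lists.\<close>

lemma algebraic_rel_closed:
  assumes R: "algebraic_rel \<sigma> M n R" and s: "\<sigma> s = Some k" and ts: "length ts = k" "set ts \<subseteq> R"
  shows "map (\<lambda>j. oper M s (map (\<lambda>t. t ! j) ts)) [0..<n] \<in> R"
proof -
  have len: "length t = n" if "t \<in> R" for t using R that by (simp add: algebraic_rel_def)
  have "oper (alg_power M {..<n}) s (map list_tuple ts) \<in> list_tuple ` R"
    using R s ts by (simp add: algebraic_rel_def subalgebra_def subuniverse_def image_mono)
  then obtain r where r: "r \<in> R" "oper (alg_power M {..<n}) s (map list_tuple ts) = list_tuple r" by blast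
  have "map (\<lambda>j. oper M s (map (\<lambda>t. t ! j) ts)) [0..<n] = r"
  proof (rule nth_equalityI)
    fix j assume "j < length (map (\<lambda>j. oper M s (map (\<lambda>t. t ! j) ts)) [0..<n])"
    then have j: "j < n" by simp
    have m: "map (\<lambda>x. x j) (map list_tuple ts) = map (\<lambda>t. t ! j) ts"
      using len ts(2) j by (auto simp: list_tuple_def)
    have "oper M s (map (\<lambda>t. t ! j) ts) = oper (alg_power M {..<n}) s (map list_tuple ts) j"
      using j by (simp add: alg_power_def m del: map_map)
    also have "\<dots> = r ! j" using j len[OF r(1)] by (simp add: r(2) list_tuple_def)
    finally show "map (\<lambda>j. oper M s (map (\<lambda>t. t ! j) ts)) [0..<n] ! j = r ! j" using j by simp
  qed (simp add: len[OF r(1)])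
  then show ?thesis using r(1) by simp
qed

text \<open>Applying a basic operation \<open>s\<close> coordinatewise to the graph elements above
  the entries of \<open>as\<close> gives another graph element. Its first n entries are those above
  \<open>oper A s as\<close>, because the \<open>xs\<close> are homomorphisms, so
  \<open>func\<close> forces the last entries to agree as well. This closes the set of homomorphisms
  under the total and partial operations of an alter ego.\<close>

lemma alg_hom_of_algebraic_graph:
  assumes A: "is_algebra \<sigma> A" and R: "algebraic_rel \<sigma> M (Suc n) R"
    and func: "\<And>zs u v. zs @ [u] \<in> R \<Longrightarrow> zs @ [v] \<in> R \<Longrightarrow> u = v"
    and xs: "set xs \<subseteq> alg_hom \<sigma> A M" "length xs = n"
    and y: "y \<in> extensional (universe A)" "\<And>a. a \<in> universe A \<Longrightarrow> map (\<lambda>x. x a) xs @ [y a] \<in> R"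
  shows "y \<in> alg_hom \<sigma> A M"
proof (rule alg_homI)
  show "y a \<in> universe M" if "a \<in> universe A" for a
  proof -
    have "list_tuple (map (\<lambda>x. x a) xs @ [y a]) \<in> universe (alg_power M {..<Suc n})"
      using R y(2)[OF that] unfolding algebraic_rel_def subalgebra_def subuniverse_def by blast
    then have "list_tuple (map (\<lambda>x. x a) xs @ [y a]) n \<in> universe M"
      by (auto simp: alg_power_def)
    then show ?thesis using xs(2) by (simp add: list_tuple_def nth_append)
  qed
  fix s k as assume a: "\<sigma> s = Some k" "length as = k" "set as \<subseteq> universe A"
  let ?ts = "map (\<lambda>a. map (\<lambda>x. x a) xs @ [y a]) as"
  have "map (\<lambda>j. oper M s (map (\<lambda>t. t ! j) ?ts)) [0..<Suc n] \<in> R"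
    by (rule algebraic_rel_closed[OF R a(1)]) (use a y(2) in auto)
  moreover have "map (\<lambda>j. oper M s (map (\<lambda>t. t ! j) ?ts)) [0..<Suc n]
      = map (\<lambda>x. x (oper A s as)) xs @ [oper M s (map y as)]"
  proof (rule nth_equalityI)
    fix j assume "j < length (map (\<lambda>j. oper M s (map (\<lambda>t. t ! j) ?ts)) [0..<Suc n])"
    then consider "j < n" | "j = n" by fastforce
    then show "map (\<lambda>j. oper M s (map (\<lambda>t. t ! j) ?ts)) [0..<Suc n] ! j
        = (map (\<lambda>x. x (oper A s as)) xs @ [oper M s (map y as)]) ! j"
    proof cases
      case 1
      then have h: "xs ! j \<in> alg_hom \<sigma> A M" using xs by auto
      have "map (\<lambda>t. t ! j) ?ts = map (xs ! j) as" using 1 xs(2) by (simp add: nth_append)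
      then show ?thesis using 1 xs(2) alg_homD(3)[OF h a]
        by (simp add: nth_append del: upt_Suc map_map)
    next
      case 2
      have "map (\<lambda>t. t ! n) ?ts = map y as" using xs(2) by (simp add: nth_append)
      then show ?thesis using 2 xs(2) by (simp add: nth_append del: upt_Suc map_map)
    qed
  qed (simp add: xs(2))
  moreover have "map (\<lambda>x. x (oper A s as)) xs @ [y (oper A s as)] \<in> R"
    by (rule y(2)[OF is_algebraD(2)[OF A a]])
  ultimately show "y (oper A s as) = oper M s (map y as)" using func by simp
qed (rule y(1))

lemma points_dual_str:
  assumes "alter_ego \<sigma> M \<tau> N"
  shows "points (dual_str \<sigma> M N A) = alg_hom \<sigma> A M"
  using assms by (auto simp: dual_str_def points_str_restrict points_str_power alter_ego_def alg_hom_def)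

lemma tot_op_dual_str: "tot_op (dual_str \<sigma> M N A) g xs = (\<lambda>a\<in>universe A. tot_op N g (map (\<lambda>x. x a) xs))"
  by (simp add: dual_str_def str_restrict_def str_power_def)

lemma par_op_dual_str:
  assumes "alter_ego \<sigma> M \<tau> N"
  shows "par_op (dual_str \<sigma> M N A) h xs = Some y \<longleftrightarrow>
    set xs \<subseteq> alg_hom \<sigma> A M \<and> y \<in> extensional (universe A) \<and>
    (\<forall>a\<in>universe A. par_op N h (map (\<lambda>x. x a) xs) = Some (y a))" (is "?l \<longleftrightarrow> ?r")
proof
  have N: "points N = universe M" using assms by (simp add: alter_ego_def)
  assume ?l
  then show ?r by (auto simp: dual_str_def str_restrict_def str_power_def split: if_splits)
next
  have N: "points N = universe M" using assms by (simp add: alter_ego_def)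
  assume r: ?r
  then have "set xs \<subseteq> universe A \<rightarrow>\<^sub>E universe M" by (auto simp: alg_hom_def)
  moreover have "(\<lambda>a\<in>universe A. the (par_op N h (map (\<lambda>x. x a) xs))) = y"
  proof (rule extensionalityI[of _ "universe A"])
    show "y \<in> extensional (universe A)" using r by blast
  qed (use r in auto)
  ultimately show ?l using r N by (simp add: dual_str_def str_restrict_def str_power_def)
qed

lemma rels_dual_str:
  assumes "alter_ego \<sigma> M \<tau> N"
  shows "xs \<in> rels (dual_str \<sigma> M N A) r \<longleftrightarrow>
    set xs \<subseteq> alg_hom \<sigma> A M \<and> (\<forall>a\<in>universe A. map (\<lambda>x. x a) xs \<in> rels N r)"
proof -
  have "points N = universe M" using assms by (simp add: alter_ego_def)
  moreover have "alg_hom \<sigma> A M \<subseteq> universe A \<rightarrow>\<^sub>E universe M" by (auto simp: alg_hom_def)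
  ultimately show ?thesis by (auto simp: dual_str_def str_restrict_def str_power_def)
qed

lemma is_topstr_dual_str:
  assumes ego: "alter_ego \<sigma> M \<tau> N" and A: "is_algebra \<sigma> A"
  shows "is_topstr \<tau> (dual_str \<sigma> M N A)"
  unfolding is_topstr_def points_dual_str[OF ego]
proof (intro conjI allI impI; elim conjE)
  have N: "is_topstr \<tau> N" and pN: "points N = universe M" using ego by (simp_all add: alter_ego_def)
  \<comment> \<open>A coordinate at which lengths of lists are read off: over an empty index set, a
    power would relate lists of every length.\<close>
  obtain a0 where a0: "a0 \<in> universe A" using is_algebraD(1)[OF A] by blast
  {
    fix g n xs assume a: "tot_ar \<tau> g = Some n" "length xs = n" "set xs \<subseteq> alg_hom \<sigma> A M"
    have R: "algebraic_rel \<sigma> M (Suc n) {xs @ [tot_op N g xs] | xs. length xs = n \<and> set xs \<subseteq> universe M}"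
      using ego a(1) by (simp add: alter_ego_def)
    show "tot_op (dual_str \<sigma> M N A) g xs \<in> alg_hom \<sigma> A M"
    proof (rule alg_hom_of_algebraic_graph[OF A R _ a(3,2)])
      fix b assume "b \<in> universe A"
      moreover have "set (map (\<lambda>x. x b) xs) \<subseteq> universe M" using a(3) alg_homD(2)[OF _ \<open>b \<in> universe A\<close>] by auto
      ultimately show "map (\<lambda>x. x b) xs @ [tot_op (dual_str \<sigma> M N A) g xs b]
          \<in> {xs @ [tot_op N g xs] | xs. length xs = n \<and> set xs \<subseteq> universe M}"
        using a(2) by (auto simp: tot_op_dual_str)
    qed (auto simp: tot_op_dual_str)
  next
    fix h n xs y assume a: "par_ar \<tau> h = Some n" "par_op (dual_str \<sigma> M N A) h xs = Some y"
    note p = a(2)[unfolded par_op_dual_str[OF ego]]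
    show "set xs \<subseteq> alg_hom \<sigma> A M" using p by blast
    show len: "length xs = n" using p a0 is_topstrD(2)[OF N a(1), of "map (\<lambda>x. x a0) xs"] by simp
    have R: "algebraic_rel \<sigma> M (Suc n) {xs @ [y] | xs y. par_op N h xs = Some y}"
      using ego a(1) by (simp add: alter_ego_def)
    show "y \<in> alg_hom \<sigma> A M"
      by (rule alg_hom_of_algebraic_graph[OF A R _ _ len]) (use p in auto)
  next
    fix r n xs assume a: "rel_ar \<tau> r = Some n" "xs \<in> rels (dual_str \<sigma> M N A) r"
    note p = a(2)[unfolded rels_dual_str[OF ego]]
    show "set xs \<subseteq> alg_hom \<sigma> A M" using p by blast
    show "length xs = n" using p a0 is_topstrD(3)[OF N a(1), of "map (\<lambda>x. x a0) xs"] by simp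
  }
qed

text \<open>A failure to preserve an operation at \<open>xs\<close> is visible at finitely many
  coordinates, the entries of \<open>xs\<close> and the result, so it persists on a basic open
  neighbourhood.\<close>

lemma closedin_alg_hom:
  assumes A: "is_algebra \<sigma> A"
  shows "closedin (product_topology (\<lambda>_. discrete_topology (universe M)) (universe A)) (alg_hom \<sigma> A M)"
    (is "closedin ?T _")
  unfolding closedin_def
proof
  show "alg_hom \<sigma> A M \<subseteq> topspace ?T" by (auto simp: alg_hom_def)
  show "openin ?T (topspace ?T - alg_hom \<sigma> A M)"
  proof (subst openin_subopen, rule ballI)
    fix f assume f: "f \<in> topspace ?T - alg_hom \<sigma> A M"
    then obtain s n xs where s: "\<sigma> s = Some n" "length xs = n" "set xs \<subseteq> universe A"
      "f (oper A s xs) \<noteq> oper M s (map f xs)" by (auto simp: alg_hom_def)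
    let ?F = "insert (oper A s xs) (set xs)"
    let ?U = "{g \<in> universe A \<rightarrow>\<^sub>E universe M. \<forall>a\<in>?F. g a = f a}"
    have "openin ?T ?U"
      by (rule openin_agree_on_finite) (use f s is_algebraD(2)[OF A s(1-3)] in auto)
    moreover have "g \<notin> alg_hom \<sigma> A M" if "g \<in> ?U" for g
    proof
      assume "g \<in> alg_hom \<sigma> A M"
      then have "g (oper A s xs) = oper M s (map g xs)" using alg_homD(3)[of g \<sigma> A M, OF _ s(1-3)] by simp
      moreover have "map g xs = map f xs" using that by simp
      ultimately show False using s(4) that by simp
    qed
    ultimately show "\<exists>T. openin ?T T \<and> f \<in> T \<and> T \<subseteq> topspace ?T - alg_hom \<sigma> A M"
      using f by (intro exI[of _ ?U] conjI subsetI DiffI) auto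
  qed
qed

lemma topo_dual_str:
  assumes "alter_ego \<sigma> M \<tau> N"
  shows "topo (dual_str \<sigma> M N A) =
    subtopology (product_topology (\<lambda>_. discrete_topology (universe M)) (universe A)) (alg_hom \<sigma> A M)"
  using assms by (simp add: dual_str_def str_restrict_def str_power_def alter_ego_def)

lemma compact_space_dual_str:
  assumes ego: "alter_ego \<sigma> M \<tau> N" and "finite (universe M)" and A: "is_algebra \<sigma> A"
  shows "compact_space (topo (dual_str \<sigma> M N A))"
  unfolding topo_dual_str[OF ego]
  by (intro compact_space_subtopology closedin_compact_space closedin_alg_hom[OF A])
    (simp add: compact_space_product_topology compact_space_discrete_topology assms(2))

text \<open>The forms in which the duality for algebras is used. The third one is how elements are
  constructed later: prescribe the values under all homomorphisms to \<open>M\<close> and check that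
  they form a morphism.\<close>

lemma alg_iso_evalD:
  assumes iso: "alg_iso \<sigma> (eval_alg \<sigma> M A) A (dual_alg \<tau> M N (dual_str \<sigma> M N A))"
  shows "\<And>a b. \<lbrakk>a \<in> universe A; b \<in> universe A; \<And>x. x \<in> alg_hom \<sigma> A M \<Longrightarrow> x a = x b\<rbrakk> \<Longrightarrow> a = b"
    and "\<And>a. a \<in> universe A \<Longrightarrow> (\<lambda>x\<in>alg_hom \<sigma> A M. x a) \<in> str_hom \<tau> (dual_str \<sigma> M N A) N"
    and "\<And>v. v \<in> str_hom \<tau> (dual_str \<sigma> M N A) N \<Longrightarrow> \<exists>a\<in>universe A. \<forall>x\<in>alg_hom \<sigma> A M. v x = x a"
proof -
  have bij: "bij_betw (eval_alg \<sigma> M A) (universe A) (str_hom \<tau> (dual_str \<sigma> M N A) N)"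
    using iso by (simp add: alg_iso_def dual_alg_def)
  have ev: "eval_alg \<sigma> M A a = (\<lambda>x\<in>alg_hom \<sigma> A M. x a)" if "a \<in> universe A" for a
    using that by (simp add: eval_alg_def)
  show "a = b" if "a \<in> universe A" "b \<in> universe A" "\<And>x. x \<in> alg_hom \<sigma> A M \<Longrightarrow> x a = x b" for a b
  proof -
    have "eval_alg \<sigma> M A a = eval_alg \<sigma> M A b"
      unfolding ev[OF that(1)] ev[OF that(2)] by (rule restrict_ext) (rule that(3))
    then show ?thesis using bij that(1,2) by (meson bij_betw_def inj_onD)
  qed
  show "(\<lambda>x\<in>alg_hom \<sigma> A M. x a) \<in> str_hom \<tau> (dual_str \<sigma> M N A) N" if "a \<in> universe A" for a
    using bij_betwE[OF bij] that ev[OF that] by metis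
  show "\<exists>a\<in>universe A. \<forall>x\<in>alg_hom \<sigma> A M. v x = x a"
    if v: "v \<in> str_hom \<tau> (dual_str \<sigma> M N A) N" for v
  proof -
    obtain a where "a \<in> universe A" "v = eval_alg \<sigma> M A a"
      using bij v by (metis bij_betw_imp_surj_on imageE)
    then show ?thesis using ev by auto
  qed
qed

text \<open>The dual sits in the power of \<open>N\<close> over the universe of \<open>A\<close>,
  and its coordinate maps are the evaluations; separation and reflection therefore hold by the
  pointwise definition of that power.\<close>

lemma in_ISP_closed_copy_dual_str:
  fixes c :: "('a \<Rightarrow> 'm) \<Rightarrow> 'x"
  assumes c: "inj c" and ego: "alter_ego \<sigma> M \<tau> N" and fin: "finite (universe M)"
    and A: "is_algebra \<sigma> A"
    and iso: "alg_iso \<sigma> (eval_alg \<sigma> M A) A (dual_alg \<tau> M N (dual_str \<sigma> M N A))"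
  shows "in_ISP_closed \<tau> N (str_copy c (dual_str \<sigma> M N A))"
proof -
  let ?X = "dual_str \<sigma> M N A" and ?e = "\<lambda>a. \<lambda>x\<in>alg_hom \<sigma> A M. x a"
  note p = points_dual_str[OF ego, of A]
  have me: "map (?e a) xs = map (\<lambda>x. x a) xs" if "set xs \<subseteq> alg_hom \<sigma> A M" for a xs
    using that by (simp add: subset_iff)
  show ?thesis
  proof (rule in_ISP_closed_str_copyI[OF c is_topstr_dual_str[OF ego A] compact_space_dual_str[OF ego fin A],
        where I = "?e ` universe A"])
    show "Hausdorff_space (topo N)" using ego by (simp add: alter_ego_def)
    show "?e ` universe A \<noteq> {}" using is_algebraD(1)[OF A] by simp
    show "?e ` universe A \<subseteq> str_hom \<tau> ?X N" using alg_iso_evalD(2)[OF iso] by blast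
    show "x = y" if a: "x \<in> points ?X" "y \<in> points ?X" "\<forall>i\<in>?e ` universe A. i x = i y" for x y
    proof (rule extensionalityI[of _ "universe A"])
      show "x \<in> extensional (universe A)" "y \<in> extensional (universe A)" using a(1,2) p alg_homD(1) by blast+
      fix b assume "b \<in> universe A"
      then have "?e b x = ?e b y" using a(3) by blast
      then show "x b = y b" using a(1,2) p by simp
    qed
    show "par_op ?X h xs \<noteq> None" if a: "par_ar \<tau> h = Some n" "set xs \<subseteq> points ?X"
      "\<forall>i\<in>?e ` universe A. par_op N h (map i xs) \<noteq> None" for h n xs
    proof -
      have xs: "set xs \<subseteq> alg_hom \<sigma> A M" using a(2) p by simp
      have "par_op N h (map (\<lambda>x. x b) xs) \<noteq> None" if "b \<in> universe A" for b
      proof -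
        have "par_op N h (map (?e b) xs) \<noteq> None" using a(3) that by blast
        then show ?thesis unfolding me[OF xs] .
      qed
      then have "par_op ?X h xs = Some (\<lambda>b\<in>universe A. the (par_op N h (map (\<lambda>x. x b) xs)))"
        unfolding par_op_dual_str[OF ego] using xs by simp
      then show ?thesis by simp
    qed
    show "xs \<in> rels ?X r" if a: "rel_ar \<tau> r = Some n" "set xs \<subseteq> points ?X"
      "\<forall>i\<in>?e ` universe A. map i xs \<in> rels N r" for r n xs
    proof -
      have xs: "set xs \<subseteq> alg_hom \<sigma> A M" using a(2) p by simp
      have "map (\<lambda>x. x b) xs \<in> rels N r" if "b \<in> universe A" for b
      proof -
        have "map (?e b) xs \<in> rels N r" using a(3) that by blast
        then show ?thesis unfolding me[OF xs] .
      qed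
      then show ?thesis unfolding rels_dual_str[OF ego] using xs by simp
    qed
  qed
qed

text \<open>The identity alone embeds \<open>N\<close> into its first power. The copy will serve as
  the target in the universal property of a coproduct.\<close>

lemma in_ISP_closed_copy_self:
  fixes c :: "'m \<Rightarrow> 'x"
  assumes c: "inj c" and N: "is_topstr \<tau> N" "compact_space (topo N)" "Hausdorff_space (topo N)"
  shows "in_ISP_closed \<tau> N (str_copy c N)"
proof -
  let ?i = "\<lambda>x\<in>points N. x"
  have m: "map ?i xs = xs" if "set xs \<subseteq> points N" for xs using that by (simp add: map_idI subset_iff)
  have hom: "?i \<in> str_hom \<tau> N N"
  proof (rule str_homI)
    show "continuous_map (topo N) (topo N) ?i" by (rule continuous_map_eq[OF continuous_map_id]) simp
    show "?i (tot_op N g xs) = tot_op N g (map ?i xs)"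
      if a: "tot_ar \<tau> g = Some n" "length xs = n" "set xs \<subseteq> points N" for g n xs
      using is_topstrD(1)[OF N(1) a] unfolding m[OF a(3)] by simp
    show "par_op N h (map ?i xs) = Some (?i y)" if a: "par_ar \<tau> h = Some n" "par_op N h xs = Some y" for h n xs y
      using is_topstrD(2)[OF N(1) a] a m[of xs] by simp
    show "map ?i xs \<in> rels N r" if a: "rel_ar \<tau> r = Some n" "xs \<in> rels N r" for r n xs
      using is_topstrD(3)[OF N(1) a] a m[of xs] by simp
  qed simp
  show ?thesis
    by (rule in_ISP_closed_str_copyI[OF c N, where I = "{?i}"]) (use hom m in auto)
qed

text \<open>The image of an embedding is a substructure, hence contains the values of the nullary
  operations. In a nonempty direct union the constants are thus covered by every piece.\<close>

lemma const_points_subset_image: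
  assumes "str_embedding \<tau> f X Z"
  shows "const_points \<tau> Z \<subseteq> f ` points X"
proof -
  obtain S where S: "closed_substr \<tau> S Z" "str_iso \<tau> f X (str_restrict Z S)"
    using assms by (auto simp: str_embedding_def)
  have SZ: "S \<subseteq> points Z" using S(1) by (simp add: closed_substr_def closedin_subset)
  obtain f' where f': "f' \<in> str_hom \<tau> (str_restrict Z S) X"
    "\<forall>y\<in>points (str_restrict Z S). f (f' y) = y" using S(2) by (auto simp: str_iso_def)
  have "y \<in> f ` points X" if "y \<in> S" for y
  proof -
    have "y \<in> points (str_restrict Z S)" using that SZ by (auto simp: points_str_restrict)
    then show ?thesis using f'(2) str_homD(3)[OF f'(1)] by (metis imageI)
  qed
  moreover have "const_points \<tau> Z \<subseteq> S"
    using S(1) by (auto simp: const_points_def closed_substr_def)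
  ultimately show ?thesis by blast
qed

section \<open>Homomorphisms from a power to the generating algebra\<close>

text \<open>Factoring through the projection to coordinate \<open>i\<close>, tested on constant
  tuples so that no factor map has to be named.\<close>

definition factors_at :: "('a, 'f) alg \<Rightarrow> nat \<Rightarrow> ((nat \<Rightarrow> 'a) \<Rightarrow> 'b) \<Rightarrow> nat \<Rightarrow> bool" where
  "factors_at A n w i \<longleftrightarrow> i \<in> {1..n} \<and>
     (\<forall>a \<in> {1..n} \<rightarrow>\<^sub>E universe A. w a = w (\<lambda>_\<in>{1..n}. a i))"

lemma universe_alg_power: "universe (alg_power A I) = (I \<rightarrow>\<^sub>E universe A)"
  by (simp add: alg_power_def)

lemma oper_alg_power: "oper (alg_power A I) s xs = (\<lambda>i\<in>I. oper A s (map (\<lambda>x. x i) xs))"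
  by (simp add: alg_power_def)

lemma is_algebra_alg_power:
  assumes A: "is_algebra \<sigma> A"
  shows "is_algebra \<sigma> (alg_power A I)"
  unfolding is_algebra_def subuniverse_def universe_alg_power
proof (intro conjI allI impI)
  show "(I \<rightarrow>\<^sub>E universe A) \<noteq> {}" using is_algebraD(1)[OF A] by (simp add: PiE_eq_empty_iff)
  fix s n xs assume a: "\<sigma> s = Some n \<and> length xs = n \<and> set xs \<subseteq> I \<rightarrow>\<^sub>E universe A"
  have "oper A s (map (\<lambda>x. x i) xs) \<in> universe A" if "i \<in> I" for i
    by (rule is_algebraD(2)[OF A, of s n]) (use a that in auto)
  then show "oper (alg_power A I) s xs \<in> I \<rightarrow>\<^sub>E universe A" by (simp add: oper_alg_power)
qed simp

text \<open>The coproduct of \<open>n\<close> copies of the dual of \<open>A\<close> is the dual of \<open>A\<^sup>n\<close>; since it is covered by the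
  copies, every homomorphism from \<open>A\<^sup>n\<close> to \<open>M\<close> factors through a projection, and related homomorphisms
  factor through a common one.\<close>

lemma common_factor_index:
  fixes \<sigma> :: "'f \<rightharpoonup> nat" and M :: "('m, 'f) alg"
    and \<tau> :: "('g, 'h, 'r) strsig" and N :: "('m, 'g, 'h, 'r) topstr"
    and A :: "('u, 'f) alg"
  assumes ego: "alter_ego \<sigma> M \<tau> N" and fin: "finite (universe M)"
    and log: "logarithmic_duality TYPE('u) TYPE(nat \<times> ('u \<Rightarrow> 'm)) \<sigma> M \<tau> N"
    and A: "in_ISP \<sigma> M A" and n: "n \<ge> 1"
    and ws: "set ws \<subseteq> alg_hom \<sigma> (alg_power A {1..n}) M"
    and rel: "length ws = 1 \<or> (\<exists>r k. rel_ar \<tau> r = Some k \<and>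
        (\<forall>a \<in> {1..n} \<rightarrow>\<^sub>E universe A. map (\<lambda>w. w a) ws \<in> rels N r))"
  shows "\<exists>i. \<forall>w\<in>set ws. factors_at A n w i"
proof -
  \<comment> \<open>The duality speaks about structures on the type of pairs, so the dual of \<open>A\<close> and \<open>N\<close> are copied there.\<close>
  define c where "c = (Pair 0 :: _ \<Rightarrow> nat \<times> ('u \<Rightarrow> 'm))"
  define d where "d = (\<lambda>m. (0, \<lambda>_. m) :: nat \<times> ('u \<Rightarrow> 'm))"
  have c: "inj c" by (simp add: c_def inj_def)
  have d: "inj d" by (simp add: d_def inj_def fun_eq_iff)
  let ?D = "dual_str \<sigma> M N A" and ?P = "{1..n} \<rightarrow>\<^sub>E universe A"
  define X where "X = str_copy c ?D"
  define K where "K = str_copy d N"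
  have algA: "is_algebra \<sigma> A" using A by (simp add: in_ISP_def)
  have iso: "alg_iso \<sigma> (eval_alg \<sigma> M A) A (dual_alg \<tau> M N ?D)"
    using log A by (simp add: logarithmic_duality_def full_duality_def)
  have N: "is_topstr \<tau> N" and tN: "topo N = discrete_topology (universe M)"
    using ego by (simp_all add: alter_ego_def)
  have Xin: "in_ISP_closed \<tau> N X" unfolding X_def by (rule in_ISP_closed_copy_dual_str[OF c ego fin algA iso])
  have Kin: "in_ISP_closed \<tau> N K" unfolding K_def
    by (rule in_ISP_closed_copy_self[OF d N]) (simp_all add: tN compact_space_discrete_topology fin)
  note D = is_topstr_dual_str[OF ego algA]
  have X: "is_topstr \<tau> X" unfolding X_def by (rule is_topstr_str_copy[OF c D])
  have pX: "points X = c ` alg_hom \<sigma> A M"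
    unfolding X_def points_str_copy[OF c] points_dual_str[OF ego] ..
  obtain Z u where cop: "is_coproduct \<tau> N {1..n} (\<lambda>_. X) Z u" and du: "is_direct_union \<tau> {1..n} (\<lambda>_. X) Z u"
  proof -
    have "\<forall>(n :: nat) X :: nat \<Rightarrow> (nat \<times> ('u \<Rightarrow> 'm), 'g, 'h, 'r) topstr. (\<forall>i\<in>{1..n}. in_ISP_closed \<tau> N (X i)) \<longrightarrow>
        (\<exists>Z u. is_coproduct \<tau> N {1..n} X Z u \<and> is_direct_union \<tau> {1..n} X Z u)"
      using log by (simp add: logarithmic_duality_def coproducts_are_direct_unions_def)
    from this[rule_format, of n "\<lambda>_. X"] show thesis using Xin that by blast
  qed
  have Zin: "in_ISP_closed \<tau> N Z" using cop by (simp add: is_coproduct_def)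
  have Z: "is_topstr \<tau> Z" using Zin by (simp add: in_ISP_closed_def)
  have u: "u i \<in> str_hom \<tau> X Z" if "i \<in> {1..n}" for i using cop that by (simp add: is_coproduct_def)
  have const: "const_points \<tau> Z \<subseteq> u 1 ` points X"
    by (rule const_points_subset_image) (use du n in \<open>simp add: is_direct_union_def\<close>)
  have "points Z = const_points \<tau> Z \<union> (\<Union>i\<in>{1..n}. u i ` points X)"
    using du by (simp add: is_direct_union_def)
  then have pZ: "points Z = (\<Union>i\<in>{1..n}. u i ` points X)" using const n by auto
  have cover: "\<exists>i\<in>{1..n}. \<exists>x\<in>alg_hom \<sigma> A M. z = u i (c x)" if "z \<in> points Z" for z
    using that unfolding pZ pX by blast
  have uZ: "u i (c x) \<in> points Z" if "i \<in> {1..n}" "x \<in> alg_hom \<sigma> A M" for i x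
    using that pX str_homD(3)[OF u] by blast
  have agree: "w = w'" if "w \<in> extensional (points Z)" "w' \<in> extensional (points Z)"
    "\<And>i x. \<lbrakk>i \<in> {1..n}; x \<in> alg_hom \<sigma> A M\<rbrakk> \<Longrightarrow> w (u i (c x)) = w' (u i (c x))" for w w' :: "_ \<Rightarrow> 'm"
  proof (rule extensionalityI[OF that(1,2)])
    fix z assume "z \<in> points Z"
    then obtain i x where "i \<in> {1..n}" "x \<in> alg_hom \<sigma> A M" "z = u i (c x)" using cover by blast
    then show "w z = w' z" using that(3) by simp
  qed
  have ex: "\<exists>w. w \<in> str_hom \<tau> Z N \<and> (\<forall>i\<in>{1..n}. \<forall>x\<in>alg_hom \<sigma> A M. w (u i (c x)) = x (a i))"
    if a: "a \<in> ?P" for a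
  proof -
    \<comment> \<open>Leg \<open>i\<close> of the cocone is evaluation at \<open>a i\<close>. The
      outer maps only lead from \<open>X\<close> to the dual of \<open>A\<close> and from
      \<open>N\<close> to its copy \<open>K\<close>, since the universal property admits targets on
      the type of \<open>X\<close> only.\<close>
    define v where "v = (\<lambda>i. \<lambda>p\<in>points X. (\<lambda>m\<in>points N. d m) ((\<lambda>p\<in>points X. (\<lambda>x\<in>alg_hom \<sigma> A M. x (a i))
        ((\<lambda>x\<in>c ` points ?D. inv c x) p)) p))"
    have "v i \<in> str_hom \<tau> X K" if "i \<in> {1..n}" for i
    proof -
      have ai: "a i \<in> universe A" using a that by auto
      have "(\<lambda>p\<in>points X. (\<lambda>x\<in>alg_hom \<sigma> A M. x (a i)) ((\<lambda>x\<in>c ` points ?D. inv c x) p)) \<in> str_hom \<tau> X N"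
        by (rule str_hom_compose[OF X copy_inv_str_hom[OF c D, folded X_def] alg_iso_evalD(2)[OF iso ai]])
      then show ?thesis unfolding v_def
        by (rule str_hom_compose[OF X _ copy_map_str_hom[OF d N, folded K_def]])
    qed
    then have v: "\<forall>i\<in>{1..n}. v i \<in> str_hom \<tau> X K" by blast
    have "\<forall>(W :: (nat \<times> ('u \<Rightarrow> 'm), 'g, 'h, 'r) topstr) v. in_ISP_closed \<tau> N W \<and> (\<forall>i\<in>{1..n}. v i \<in> str_hom \<tau> X W) \<longrightarrow>
        (\<exists>!w. w \<in> str_hom \<tau> Z W \<and> (\<forall>i\<in>{1..n}. \<forall>p\<in>points X. w (u i p) = v i p))"
      using cop by (simp add: is_coproduct_def)
    from mp[OF spec[OF spec[OF this, of K], of v] conjI[OF Kin v]]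
    obtain w0 where w0: "w0 \<in> str_hom \<tau> Z K" "\<forall>i\<in>{1..n}. \<forall>p\<in>points X. w0 (u i p) = v i p"
      by blast
    define w where "w = (\<lambda>z\<in>points Z. (\<lambda>x\<in>d ` points N. inv d x) (w0 z))"
    have "w \<in> str_hom \<tau> Z N" unfolding w_def
      by (rule str_hom_compose[OF Z w0(1) copy_inv_str_hom[OF d N, folded K_def]])
    moreover have "w (u i (c x)) = x (a i)" if i: "i \<in> {1..n}" and x: "x \<in> alg_hom \<sigma> A M" for i x
    proof -
      have "x (a i) \<in> points N" using alg_homD(2)[OF x PiE_mem[OF a i]] tN by simp
      moreover have "w0 (u i (c x)) = v i (c x)" using w0(2) i x pX by blast
      moreover have "v i (c x) = d (x (a i))"
        using x c pX \<open>x (a i) \<in> points N\<close> by (simp add: v_def points_dual_str[OF ego])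
      ultimately show ?thesis using uZ[OF i x] d by (simp add: w_def)
    qed
    ultimately show ?thesis by blast
  qed
  \<comment> \<open>Each tuple glues to one morphism on \<open>Z\<close>. The next facts make
    \<open>\<alpha>\<close> an isomorphism from the power of \<open>A\<close> to the dual algebra of
    \<open>Z\<close>: surjective because a morphism restricts to an evaluation on every copy,
    injective because homomorphisms to \<open>M\<close> separate elements of
    \<open>A\<close>.\<close>
  define \<alpha> where "\<alpha> = (\<lambda>a. SOME w. w \<in> str_hom \<tau> Z N \<and>
      (\<forall>i\<in>{1..n}. \<forall>x\<in>alg_hom \<sigma> A M. w (u i (c x)) = x (a i)))"
  have \<alpha>: "\<alpha> a \<in> str_hom \<tau> Z N" and \<alpha>u: "\<And>i x. \<lbrakk>i \<in> {1..n}; x \<in> alg_hom \<sigma> A M\<rbrakk> \<Longrightarrow> \<alpha> a (u i (c x)) = x (a i)"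
    if "a \<in> ?P" for a
    using someI_ex[OF ex[OF that]] unfolding \<alpha>_def by simp_all
  have surj: "\<exists>a\<in>?P. e = \<alpha> a" if e: "e \<in> str_hom \<tau> Z N" for e
  proof -
    have "\<exists>b\<in>universe A. \<forall>x\<in>alg_hom \<sigma> A M. e (u i (c x)) = x b" if i: "i \<in> {1..n}" for i
    proof -
      define e1 where "e1 = (\<lambda>p\<in>points X. e (u i p))"
      have e1: "e1 \<in> str_hom \<tau> X N" unfolding e1_def by (rule str_hom_compose[OF X u[OF i] e])
      have "(\<lambda>x\<in>points ?D. e1 ((\<lambda>x\<in>points ?D. c x) x)) \<in> str_hom \<tau> ?D N"
        by (rule str_hom_compose[OF D copy_map_str_hom[OF c D, folded X_def] e1])
      from alg_iso_evalD(3)[OF iso this] show ?thesis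
        using pX by (auto simp: points_dual_str[OF ego] e1_def)
    qed
    then have "\<forall>i\<in>{1..n}. \<exists>b. b \<in> universe A \<and> (\<forall>x\<in>alg_hom \<sigma> A M. e (u i (c x)) = x b)" by blast
    from bchoice[OF this] obtain b
      where b: "\<forall>i\<in>{1..n}. b i \<in> universe A \<and> (\<forall>x\<in>alg_hom \<sigma> A M. e (u i (c x)) = x (b i))" ..
    define a where "a = (\<lambda>i\<in>{1..n}. b i)"
    have aP: "a \<in> ?P" using b by (auto simp: a_def)
    have "e = \<alpha> a"
      by (rule agree[OF str_homD(1)[OF e] str_homD(1)[OF \<alpha>[OF aP]]])
        (use b \<alpha>u[OF aP] in \<open>simp add: a_def\<close>)
    then show ?thesis using aP by blast
  qed
  have inj: "inj_on \<alpha> ?P"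
  proof (rule inj_onI)
    fix a b assume ab: "a \<in> ?P" "b \<in> ?P" "\<alpha> a = \<alpha> b"
    have "a i = b i" if i: "i \<in> {1..n}" for i
    proof (rule alg_iso_evalD(1)[OF iso])
      show "a i \<in> universe A" "b i \<in> universe A" using ab i by auto
      show "x (a i) = x (b i)" if "x \<in> alg_hom \<sigma> A M" for x
        using \<alpha>u[OF ab(1) i that] \<alpha>u[OF ab(2) i that] ab(3) by simp
    qed
    then show "a = b" using ab(1,2) by (meson PiE_ext)
  qed
  let ?E = "dual_alg \<tau> M N Z" and ?A = "alg_power A {1..n}"
  have uE: "universe ?E = str_hom \<tau> Z N" by (simp add: dual_alg_def)
  have oE: "oper ?E s xs = (\<lambda>z\<in>points Z. oper M s (map (\<lambda>x. x z) xs))" for s xs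
    by (simp add: dual_alg_def alg_power_def)
  have algP: "is_algebra \<sigma> ?A" by (rule is_algebra_alg_power[OF algA])
  have \<alpha>op: "\<alpha> (oper ?A s as) = oper ?E s (map \<alpha> as)"
    if s: "\<sigma> s = Some k" "length as = k" "set as \<subseteq> ?P" for s k as
  proof -
    have sP: "oper ?A s as \<in> ?P" using is_algebraD(2)[OF algP s(1,2)] s(3) by (simp add: universe_alg_power)
    show ?thesis
    proof (rule agree)
      show "\<alpha> (oper ?A s as) \<in> extensional (points Z)" by (rule str_homD(1)[OF \<alpha>[OF sP]])
      show "oper ?E s (map \<alpha> as) \<in> extensional (points Z)" by (simp add: oE)
      fix i x assume ix: "i \<in> {1..n}" "x \<in> alg_hom \<sigma> A M"
      have "x (oper A s (map (\<lambda>a. a i) as)) = oper M s (map x (map (\<lambda>a. a i) as))"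
        by (rule alg_homD(3)[OF ix(2) s(1)]) (use s PiE_mem[OF _ ix(1), of _ "\<lambda>_. universe A"] in auto)
      moreover have "map x (map (\<lambda>a. a i) as) = map (\<lambda>w. w (u i (c x))) (map \<alpha> as)"
        using \<alpha>u[OF _ ix] s(3) by (simp add: subset_iff)
      ultimately show "\<alpha> (oper ?A s as) (u i (c x)) = oper ?E s (map \<alpha> as) (u i (c x))"
        unfolding \<alpha>u[OF sP ix] oE using uZ[OF ix] ix(1) by (simp add: oper_alg_power del: map_map)
    qed
  qed
  define \<beta> where "\<beta> = inv_into ?P \<alpha>"
  have \<beta>: "\<beta> e \<in> ?P" "\<alpha> (\<beta> e) = e" if "e \<in> str_hom \<tau> Z N" for e
  proof -
    have "e \<in> \<alpha> ` ?P" using surj[OF that] by blast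
    then show "\<beta> e \<in> ?P" "\<alpha> (\<beta> e) = e" unfolding \<beta>_def by (rule inv_into_into, rule f_inv_into_f)
  qed
  have \<beta>\<alpha>: "\<beta> (\<alpha> a) = a" if "a \<in> ?P" for a unfolding \<beta>_def by (rule inv_into_f_f[OF inj that])
  \<comment> \<open>The duality for structures represents homomorphisms defined on the dual algebra
    of \<open>Z\<close>, so \<open>w\<close> is first moved there along the inverse
    \<open>\<beta>\<close> of \<open>\<alpha>\<close>.\<close>
  define lift where "lift = (\<lambda>w :: (nat \<Rightarrow> 'u) \<Rightarrow> 'm. \<lambda>e\<in>str_hom \<tau> Z N. w (\<beta> e))"
  have lift: "lift w \<in> alg_hom \<sigma> ?E M" if w: "w \<in> alg_hom \<sigma> ?A M" for w
  proof (rule alg_homI)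
    show "lift w \<in> extensional (universe ?E)" by (simp add: lift_def uE)
    show "lift w e \<in> universe M" if "e \<in> universe ?E" for e
      using that alg_homD(2)[OF w] \<beta>(1) by (simp add: lift_def uE universe_alg_power)
    fix s k es assume s: "\<sigma> s = Some k" "length es = k" "set es \<subseteq> universe ?E"
    have bs: "set (map \<beta> es) \<subseteq> ?P" using s(3) \<beta>(1) by (auto simp: uE)
    have es: "map \<alpha> (map \<beta> es) = es" using s(3) \<beta>(2) by (simp add: uE map_idI subset_iff)
    have sP: "oper ?A s (map \<beta> es) \<in> ?P"
      using is_algebraD(2)[OF algP s(1), of "map \<beta> es"] s(2) bs by (simp add: universe_alg_power)
    have eq: "oper ?E s es = \<alpha> (oper ?A s (map \<beta> es))"
      using \<alpha>op[OF s(1) _ bs] s(2) es by simp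
    have "lift w (oper ?E s es) = w (oper ?A s (map \<beta> es))"
      unfolding eq lift_def using \<alpha>[OF sP] \<beta>\<alpha>[OF sP] by simp
    also have "\<dots> = oper M s (map w (map \<beta> es))"
      by (rule alg_homD(3)[OF w s(1)]) (use s(2) bs in \<open>simp_all add: universe_alg_power\<close>)
    also have "map w (map \<beta> es) = map (lift w) es" using s(3) by (simp add: lift_def uE subset_iff)
    finally show "lift w (oper ?E s es) = oper M s (map (lift w) es)" .
  qed
  let ?DE = "dual_str \<sigma> M N ?E"
  have "str_iso \<tau> (eval_str \<tau> N Z) Z ?DE"
    using log Zin by (simp add: logarithmic_duality_def full_duality_def)
  then obtain \<phi> where \<phi>: "\<phi> \<in> str_hom \<tau> ?DE Z" "\<forall>y\<in>points ?DE. eval_str \<tau> N Z (\<phi> y) = y"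
    unfolding str_iso_def by blast
  \<comment> \<open>\<open>\<zeta> w\<close> is the point of \<open>Z\<close> that represents
    \<open>w\<close>: the value of \<open>w\<close> at \<open>a\<close> is that of
    \<open>\<alpha> a\<close> at this point. If the point lies in copy \<open>i\<close>, only the
    entry \<open>a i\<close> is read.\<close>
  define \<zeta> where "\<zeta> = (\<lambda>w. \<phi> (lift w))"
  have \<zeta>Z: "\<zeta> w \<in> points Z" and \<zeta>: "\<And>a. a \<in> ?P \<Longrightarrow> w a = \<alpha> a (\<zeta> w)" if w: "w \<in> alg_hom \<sigma> ?A M" for w
  proof -
    have l: "lift w \<in> points ?DE" using lift[OF w] by (simp add: points_dual_str[OF ego])
    show z: "\<zeta> w \<in> points Z" unfolding \<zeta>_def by (rule str_homD(3)[OF \<phi>(1) l])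
    fix a assume a: "a \<in> ?P"
    have "eval_str \<tau> N Z (\<zeta> w) (\<alpha> a) = lift w (\<alpha> a)" using \<phi>(2) l by (simp add: \<zeta>_def)
    then show "w a = \<alpha> a (\<zeta> w)"
      using z \<alpha>[OF a] \<beta>\<alpha>[OF a] by (simp add: eval_str_def lift_def)
  qed
  have fact: "factors_at A n w i" if w: "w \<in> alg_hom \<sigma> ?A M" and i: "i \<in> {1..n}" "\<zeta> w \<in> u i ` points X" for w i
  proof -
    obtain x where x: "x \<in> alg_hom \<sigma> A M" "\<zeta> w = u i (c x)" using i(2) unfolding pX by (elim imageE) simp
    have wx: "w a = x (a i)" if "a \<in> ?P" for a using \<zeta>[OF w that] \<alpha>u[OF that i(1) x(1)] x(2) by simp
    show ?thesis unfolding factors_at_def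
    proof (intro conjI ballI i(1))
      fix a assume a: "a \<in> ?P"
      then have "(\<lambda>_\<in>{1..n}. a i) \<in> ?P" using i(1) by auto
      then show "w a = w (\<lambda>_\<in>{1..n}. a i)" using wx a i(1) by simp
    qed
  qed
  have "\<exists>i\<in>{1..n}. \<zeta> ` set ws \<subseteq> u i ` points X"
    using rel
  proof
    assume "length ws = 1"
    then obtain w where "ws = [w]" by (auto simp: length_Suc_conv)
    moreover obtain i where "i \<in> {1..n}" "\<zeta> w \<in> u i ` points X"
      using \<zeta>Z[of w] ws \<open>ws = [w]\<close> pZ by auto
    ultimately show ?thesis by auto
  next
    assume "\<exists>r k. rel_ar \<tau> r = Some k \<and> (\<forall>a\<in>?P. map (\<lambda>w. w a) ws \<in> rels N r)"
    then obtain r k where r: "rel_ar \<tau> r = Some k" "\<forall>a\<in>?P. map (\<lambda>w. w a) ws \<in> rels N r" by (elim exE conjE)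
    \<comment> \<open>As \<open>\<phi>\<close> is a morphism, pointwise related homomorphisms become
      related points of \<open>Z\<close>, and the direct union confines these to one copy or to the
      constants.\<close>
    have "map lift ws \<in> rels ?DE r"
      unfolding rels_dual_str[OF ego]
    proof (intro conjI ballI)
      show "set (map lift ws) \<subseteq> alg_hom \<sigma> ?E M" using lift ws by auto
      fix e assume "e \<in> universe ?E"
      then have e: "e \<in> str_hom \<tau> Z N" by (simp add: uE)
      have "map (\<lambda>x. x e) (map lift ws) = map (\<lambda>w. w (\<beta> e)) ws" using e by (simp add: lift_def)
      then show "map (\<lambda>x. x e) (map lift ws) \<in> rels N r" by (simp only:) (rule bspec[OF r(2) \<beta>(1)[OF e]])
    qed
    from str_homD(6)[OF \<phi>(1) r(1) this] have "map \<zeta> ws \<in> rels Z r" by (simp add: \<zeta>_def o_def)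
    moreover have "\<forall>r n' xs. rel_ar \<tau> r = Some n' \<and> xs \<in> rels Z r \<longrightarrow>
        set xs \<subseteq> const_points \<tau> Z \<or> (\<exists>i\<in>{1..n}. set xs \<subseteq> u i ` points X)"
      using du by (simp add: is_direct_union_def)
    ultimately consider "set (map \<zeta> ws) \<subseteq> const_points \<tau> Z" | "\<exists>i\<in>{1..n}. set (map \<zeta> ws) \<subseteq> u i ` points X"
      using r(1) by meson
    then show ?thesis
    proof cases
      \<comment> \<open>Constants lie in every copy, so any index would serve.\<close>
      case 1
      then have "\<zeta> ` set ws \<subseteq> u 1 ` points X" using const by simp
      then show ?thesis using n by (intro bexI[of _ 1]) simp_all
    qed simp
  qed
  then obtain i where i: "i \<in> {1..n}" "\<zeta> ` set ws \<subseteq> u i ` points X" ..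
  have "factors_at A n w i" if "w \<in> set ws" for w
    by (rule fact) (use that ws i in auto)
  then show ?thesis by blast
qed

section \<open>Preorders given by kernels\<close>

definition kernel_partition :: "'a set \<Rightarrow> ('a \<Rightarrow> 'b) \<Rightarrow> 'a set set" where
  "kernel_partition S f = (\<lambda>j. {i \<in> S. f i = f j}) ` S"

lemma partition_on_kernel_partition: "partition_on S (kernel_partition S f)"
  by (rule partition_onI) (auto simp: kernel_partition_def disjnt_def)

lemma refines_kernel_partition:
  "refines S (kernel_partition S f) (kernel_partition S g) \<longleftrightarrow>
     (\<forall>i\<in>S. \<forall>j\<in>S. f i = f j \<longrightarrow> g i = g j)" (is "?l \<longleftrightarrow> ?r")
proof
  assume l: ?l
  show ?r
  proof (intro ballI impI)
    fix i j assume a: "i \<in> S" "j \<in> S" "f i = f j"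
    have "{k \<in> S. f k = f j} \<in> kernel_partition S f" using a(2) by (auto simp: kernel_partition_def)
    then obtain Y where Y: "Y \<in> kernel_partition S g" "{k \<in> S. f k = f j} \<subseteq> Y"
      using l by (auto simp: refines_def)
    then have "i \<in> Y" "j \<in> Y" using a by auto
    then show "g i = g j" using Y(1) by (auto simp: kernel_partition_def)
  qed
next
  assume r: ?r
  have "\<exists>Y\<in>kernel_partition S g. X \<subseteq> Y" if "X \<in> kernel_partition S f" for X
  proof -
    obtain j where j: "j \<in> S" "X = {i \<in> S. f i = f j}" using \<open>X \<in> _\<close> by (auto simp: kernel_partition_def)
    then have "X \<subseteq> {i \<in> S. g i = g j}" using r by blast
    moreover have "{i \<in> S. g i = g j} \<in> kernel_partition S g" unfolding kernel_partition_def using j(1) by blast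
    ultimately show ?thesis by blast
  qed
  then show ?l by (simp add: refines_def partition_on_kernel_partition)
qed

lemma kernel_partition_eqI:
  assumes "\<And>i j. \<lbrakk>i \<in> S; j \<in> S\<rbrakk> \<Longrightarrow> f i = f j \<longleftrightarrow> g i = g j"
  shows "kernel_partition S f = kernel_partition S g"
  unfolding kernel_partition_def by (intro image_cong refl Collect_cong conj_cong assms)

text \<open>Label each element by the least element of its block. The union in \<open>f\<close> is a
  single block by disjointness and spares a choice. The labels are natural numbers so that they can
  be used to merge arguments.\<close>

lemma partition_is_kernel_partition:
  fixes S :: "nat set"
  assumes P: "partition_on S P" and fin: "finite S"
  shows "\<exists>f :: nat \<Rightarrow> nat. kernel_partition S f = P"
proof
  define f where "f = (\<lambda>i. Min (\<Union>{X \<in> P. i \<in> X}))"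
  have blk: "\<Union>{X \<in> P. i \<in> X} = X" if "X \<in> P" "i \<in> X" for X i
  proof -
    have "{Y \<in> P. i \<in> Y} = {X}" using that partition_onD2[OF P] by (auto dest: disjointD)
    then show ?thesis by simp
  qed
  have ker: "f i = f j \<longleftrightarrow> j \<in> X" if X: "X \<in> P" "i \<in> X" and j: "j \<in> S" for X i j
  proof -
    obtain Y where Y: "Y \<in> P" "j \<in> Y" using j partition_onD1[OF P] by auto
    have finP: "finite Z" if "Z \<in> P" for Z using that partition_onD1[OF P] by (intro finite_subset[OF _ fin]) blast
    have same: "X = Y" if "z \<in> X" "z \<in> Y" for z using disjointD[OF partition_onD2[OF P] X(1) Y(1)] that by blast
    have "Min X \<in> X" "Min Y \<in> Y" using X Y finP by (auto intro: Min_in)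
    then have "Min X = Min Y \<longleftrightarrow> X = Y" using same[of "Min X"] by metis
    moreover have "X = Y \<longleftrightarrow> j \<in> X" using same[of j] Y(2) by blast
    ultimately show ?thesis by (simp add: f_def blk[OF X] blk[OF Y])
  qed
  have cls: "{i \<in> S. f i = f j} = X" if X: "X \<in> P" "j \<in> X" for X j
  proof -
    have "X \<subseteq> S" using X(1) partition_onD1[OF P] by blast
    moreover have "i \<in> X \<longleftrightarrow> f i = f j" if "i \<in> S" for i using ker[OF X that] by auto
    ultimately show ?thesis by blast
  qed
  show "kernel_partition S f = P"
  proof
    show "kernel_partition S f \<subseteq> P"
    proof
      fix Y assume "Y \<in> kernel_partition S f"
      then obtain j where j: "j \<in> S" "Y = {i \<in> S. f i = f j}" by (auto simp: kernel_partition_def)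
      then obtain X where "X \<in> P" "j \<in> X" using partition_onD1[OF P] by auto
      then show "Y \<in> P" using cls j(2) by simp
    qed
    show "P \<subseteq> kernel_partition S f"
    proof
      fix X assume X: "X \<in> P"
      then obtain j where "j \<in> X" using partition_onD3[OF P] by (metis equals0I)
      moreover from this have "j \<in> S" using X partition_onD1[OF P] by blast
      ultimately show "X \<in> kernel_partition S f" using cls[OF X] by (auto simp: kernel_partition_def)
    qed
  qed
qed

lemma factor_through_kernel:
  assumes "\<And>y y'. \<lbrakk>y \<in> W; y' \<in> W; g y = g y'\<rbrakk> \<Longrightarrow> f y = f y'"
  obtains h where "\<And>y. y \<in> W \<Longrightarrow> f y = h (g y)"
proof
  fix y assume y: "y \<in> W"
  have "inv_into W g (g y) \<in> W" "g (inv_into W g (g y)) = g y"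
    using y by (auto intro: inv_into_into f_inv_into_f)
  then show "f y = (\<lambda>i. f (inv_into W g i)) (g y)" using assms[OF y, of "inv_into W g (g y)"] by simp
qed

text \<open>Each fibre of \<open>d\<close> is directed, so by boundedness it has a greatest element; the fibre then consists
  of the coarsenings of the partition that this element induces.\<close>

lemma kernel_preorder_poset_iso:
  fixes H :: "'p set" and d :: "'p \<Rightarrow> 'd" and W :: "'d \<Rightarrow> 'w set" and idx :: "'p \<Rightarrow> 'w \<Rightarrow> nat"
    and rank :: "'p \<Rightarrow> nat" and le :: "'p \<Rightarrow> 'p \<Rightarrow> bool"
  defines "E \<equiv> {(p, q). p \<in> H \<and> q \<in> H \<and> le p q \<and> le q p}"
  defines "P \<equiv> (H // E, \<lambda>C D. \<exists>p\<in>C. \<exists>q\<in>D. le p q)"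
  assumes le: "\<And>p q. \<lbrakk>p \<in> H; q \<in> H\<rbrakk> \<Longrightarrow> le p q \<longleftrightarrow> d p = d q \<and>
      (\<forall>y\<in>W (d p). \<forall>y'\<in>W (d p). idx q y = idx q y' \<longrightarrow> idx p y = idx p y')"
    and rank: "\<And>p. p \<in> H \<Longrightarrow> rank p = card (idx p ` W (d p))"
    and fin: "\<And>p. p \<in> H \<Longrightarrow> finite (idx p ` W (d p))"
    and directed: "\<And>p q. \<lbrakk>p \<in> H; q \<in> H; d p = d q\<rbrakk> \<Longrightarrow> \<exists>r\<in>H. le p r \<and> le q r"
    and coarsen: "\<And>p t. p \<in> H \<Longrightarrow> \<exists>q\<in>H. d q = d p \<and>
      (\<forall>y\<in>W (d p). \<forall>y'\<in>W (d p). idx q y = idx q y' \<longleftrightarrow> t (idx p y) = (t (idx p y') :: nat))"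
    and bdd: "bdd_above (rank ` H)"
  shows "poset_iso P (disjoint_sum (maximal_elements P)
           (\<lambda>C. dual_poset (partition_lattice (the_elem (rank ` C)))))"
proof -
  have led: "d p = d q" if "p \<in> H" "q \<in> H" "le p q" for p q using le that by blast
  have lek: "idx p y = idx p y'"
    if "p \<in> H" "q \<in> H" "le p q" "y \<in> W (d p)" "y' \<in> W (d p)" "idx q y = idx q y'" for p q y y'
    using le[OF that(1,2)] that(3-) by blast
  have refl: "le p p" if "p \<in> H" for p using le[OF that that] by blast
  have trans: "le p r" if "p \<in> H" "q \<in> H" "r \<in> H" "le p q" "le q r" for p q r
  proof -
    have dd: "d p = d q" "d q = d r" using led that by blast+
    show ?thesis unfolding le[OF that(1,3)]
    proof (intro conjI ballI impI)
      show "d p = d r" using dd by simp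
      fix y y' assume y: "y \<in> W (d p)" "y' \<in> W (d p)" "idx r y = idx r y'"
      have "idx q y = idx q y'" by (rule lek[OF that(2,3,5) _ _ y(3)]) (use y dd in simp_all)
      then show "idx p y = idx p y'" by (rule lek[OF that(1,2,4) y(1,2)])
    qed
  qed
  have eqv: "equiv H E"
  proof (rule equivI)
    show "E \<subseteq> H \<times> H" by (auto simp: E_def)
    show "refl_on H E" using refl by (auto simp: refl_on_def E_def)
    show "sym E" by (auto simp: sym_def E_def)
    show "trans E" unfolding trans_def E_def using trans by blast
  qed
  have inE: "q \<in> E `` {p} \<longleftrightarrow> p \<in> H \<and> q \<in> H \<and> le p q \<and> le q p" for p q by (auto simp: E_def)
  have Ple: "snd P (E `` {p}) (E `` {q}) \<longleftrightarrow> le p q" if pq: "p \<in> H" "q \<in> H" for p q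
  proof
    assume "snd P (E `` {p}) (E `` {q})"
    then obtain p' q' where "p' \<in> E `` {p}" "q' \<in> E `` {q}" "le p' q'" unfolding P_def snd_conv by blast
    then have "p' \<in> H" "q' \<in> H" "le p p'" "le p' q'" "le q' q" unfolding inE by blast+
    then show "le p q" using trans[of p p' q'] trans[of p q' q] pq by blast
  next
    assume "le p q"
    moreover have "p \<in> E `` {p}" "q \<in> E `` {q}" unfolding inE using refl pq by blast+
    ultimately show "snd P (E `` {p}) (E `` {q})" unfolding P_def snd_conv by blast
  qed
  have Eeq: "E `` {p} = E `` {q} \<longleftrightarrow> le p q \<and> le q p" if "p \<in> H" "q \<in> H" for p q
    using eq_equiv_class_iff[OF eqv that] that by (simp add: E_def)
  have card_le: "rank p \<le> rank q" and card_eq: "rank p = rank q \<Longrightarrow> le q p"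
    if pq: "p \<in> H" "q \<in> H" "le p q" for p q
  proof -
    have dpq: "d q = d p" using led[OF pq] by simp
    \<comment> \<open>\<open>idx p\<close> factors through \<open>idx q\<close> by \<open>h\<close>,
      so ranks grow along \<open>le\<close>. If the finite ranks agree, \<open>h\<close> is
      injective and the comparison can be reversed.\<close>
    obtain h where h: "\<And>y. y \<in> W (d p) \<Longrightarrow> idx p y = h (idx q y)"
      using factor_through_kernel[of "W (d p)" "idx q" "idx p"] lek[OF pq] by blast
    have img: "idx p ` W (d p) = h ` (idx q ` W (d p))" using h by (auto simp: image_image)
    have finq: "finite (idx q ` W (d p))" using fin[OF pq(2)] dpq by simp
    show "rank p \<le> rank q" using card_image_le[OF finq, of h] by (simp add: rank pq(1,2) img dpq)
    assume "rank p = rank q"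
    then have "card (h ` (idx q ` W (d p))) = card (idx q ` W (d p))" by (simp add: rank pq(1,2) img dpq)
    then have "inj_on h (idx q ` W (d p))" using finq eq_card_imp_inj_on by blast
    then show "le q p" unfolding le[OF pq(2,1)] dpq using h by (auto dest!: inj_onD)
  qed
  have rankC: "the_elem (rank ` (E `` {p})) = rank p" if "p \<in> H" for p
  proof -
    have "rank q = rank p" if "q \<in> E `` {p}" for q
      using that card_le[of p q] card_le[of q p] unfolding inE by fastforce
    moreover have "p \<in> E `` {p}" unfolding inE using refl \<open>p \<in> H\<close> by blast
    ultimately have "rank ` (E `` {p}) = {rank p}" by blast
    then show ?thesis by simp
  qed
  have ex_top: "\<exists>t. t \<in> H \<and> d t = \<delta> \<and> (\<forall>p\<in>H. d p = \<delta> \<longrightarrow> le p t)" if \<delta>: "\<delta> \<in> d ` H" for \<delta>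
  proof -
    let ?F = "{p \<in> H. d p = \<delta>}"
    obtain b where b: "\<forall>p\<in>H. rank p \<le> b" using bdd unfolding bdd_above_def by auto
    obtain p0 where p0: "p0 \<in> ?F" using \<delta> by blast
    have "\<exists>t. t \<in> ?F \<and> (\<forall>p. p \<in> ?F \<longrightarrow> rank p \<le> rank t)"
      by (rule ex_has_greatest_nat[of "\<lambda>p. p \<in> ?F", OF p0, of rank "Suc b"]) (use b in \<open>simp add: less_Suc_eq_le\<close>)
    then obtain t where t: "t \<in> ?F" "\<forall>p\<in>?F. rank p \<le> rank t" by (elim exE conjE) simp
    \<comment> \<open>A common upper bound \<open>r\<close> of \<open>p\<close> and the element
      \<open>t\<close> of greatest rank has the same rank as \<open>t\<close>, so it lies below
      \<open>t\<close> again.\<close>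
    have "le p t" if p: "p \<in> H" "d p = \<delta>" for p
    proof -
      obtain r where r: "r \<in> H" "le p r" "le t r" using directed[of p t] p t(1) by auto
      have "d r = \<delta>" using led[OF p(1) r(1,2)] p(2) by simp
      then have "rank t = rank r" using bspec[OF t(2), of r] r(1) card_le[OF _ r(1,3)] t(1) by simp
      then have "le r t" using card_eq[OF _ r(1,3)] t(1) by simp
      then show ?thesis using trans[OF p(1) r(1) _ r(2)] t(1) by simp
    qed
    then show ?thesis using t(1) by blast
  qed
  define top where "top = (\<lambda>\<delta>. SOME t. t \<in> H \<and> d t = \<delta> \<and> (\<forall>p\<in>H. d p = \<delta> \<longrightarrow> le p t))"
  have top: "top \<delta> \<in> H \<and> d (top \<delta>) = \<delta> \<and> (\<forall>p\<in>H. d p = \<delta> \<longrightarrow> le p (top \<delta>))" if "\<delta> \<in> d ` H" for \<delta>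
    unfolding top_def by (rule someI_ex[OF ex_top[OF that]])
  have topH: "top (d p) \<in> H" "d (top (d p)) = d p" "le p (top (d p))" if "p \<in> H" for p
    using top[of "d p"] that by blast+
  have maxP: "maximal_elements P = (\<lambda>\<delta>. E `` {top \<delta>}) ` d ` H"
  proof (rule Set.set_eqI)
    fix C
    show "C \<in> maximal_elements P \<longleftrightarrow> C \<in> (\<lambda>\<delta>. E `` {top \<delta>}) ` d ` H"
    proof
      assume C: "C \<in> maximal_elements P"
      then have "C \<in> H // E" by (simp add: maximal_elements_def P_def)
      then obtain p where p: "p \<in> H" "C = E `` {p}" by (rule quotientE) blast
      have "E `` {top (d p)} \<in> fst P" using topH[OF p(1)] by (simp add: P_def quotientI)
      then have "E `` {top (d p)} = C"
        using C p Ple[OF p(1) topH(1)[OF p(1)]] topH(3)[OF p(1)] by (auto simp: maximal_elements_def)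
      then show "C \<in> (\<lambda>\<delta>. E `` {top \<delta>}) ` d ` H" using p(1) by blast
    next
      assume "C \<in> (\<lambda>\<delta>. E `` {top \<delta>}) ` d ` H"
      then obtain p where p: "p \<in> H" "C = E `` {top (d p)}" by blast
      have "D = C" if D: "D \<in> fst P" "snd P C D" for D
      proof -
        obtain q where q: "q \<in> H" "D = E `` {q}" using D(1) unfolding P_def fst_conv by (rule quotientE) blast
        then have l: "le (top (d p)) q" using D(2) Ple[OF topH(1)[OF p(1)]] p(2) by simp
        then have "d q = d p" using led[OF topH(1)[OF p(1)] q(1)] topH(2)[OF p(1)] by simp
        then have "le q (top (d p))" using topH(3)[OF q(1)] by simp
        then show ?thesis using l Eeq[OF q(1) topH(1)[OF p(1)]] p(2) q(2) by simp
      qed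
      then show "C \<in> maximal_elements P"
        using topH(1)[OF p(1)] p(2) by (auto simp: maximal_elements_def P_def quotientI)
    qed
  qed
  \<comment> \<open>All kernels over \<open>\<delta>\<close> are coarser than that of
    \<open>top \<delta>\<close>. One representative \<open>s \<delta> j\<close> in each of its
    \<open>k \<delta>\<close> classes therefore suffices to recover every kernel, which turns
    kernels on the possibly infinite set \<open>W \<delta>\<close> into partitions of an initial
    segment.\<close>
  define k where "k = (\<lambda>\<delta>. rank (top \<delta>))"
  have ex_s: "\<exists>s. (\<forall>j\<in>{1..k \<delta>}. s j \<in> W \<delta>) \<and>
      bij_betw (\<lambda>j. idx (top \<delta>) (s j)) {1..k \<delta>} (idx (top \<delta>) ` W \<delta>)" if \<delta>: "\<delta> \<in> d ` H" for \<delta>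
  proof -
    let ?I = "idx (top \<delta>) ` W \<delta>"
    have "finite ?I" "card ?I = k \<delta>" using top[OF \<delta>] fin[of "top \<delta>"] rank[of "top \<delta>"] by (auto simp: k_def)
    then obtain e where e: "bij_betw e {1..k \<delta>} ?I"
      using finite_same_card_bij[of "{1..k \<delta>}" ?I] by auto
    define s where "s = (\<lambda>j. inv_into (W \<delta>) (idx (top \<delta>)) (e j))"
    have ej: "e j \<in> ?I" if "j \<in> {1..k \<delta>}" for j using e that by (rule bij_betw_apply)
    have "idx (top \<delta>) (s j) = e j" if "j \<in> {1..k \<delta>}" for j unfolding s_def by (rule f_inv_into_f[OF ej[OF that]])
    moreover have "s j \<in> W \<delta>" if "j \<in> {1..k \<delta>}" for j unfolding s_def by (rule inv_into_into[OF ej[OF that]])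
    ultimately have "bij_betw (\<lambda>j. idx (top \<delta>) (s j)) {1..k \<delta>} ?I" "\<forall>j\<in>{1..k \<delta>}. s j \<in> W \<delta>"
      using e bij_betw_cong[of "{1..k \<delta>}" "\<lambda>j. idx (top \<delta>) (s j)" e ?I] by blast+
    then show ?thesis by blast
  qed
  define s where "s = (\<lambda>\<delta>. SOME s. (\<forall>j\<in>{1..k \<delta>}. s j \<in> W \<delta>) \<and>
      bij_betw (\<lambda>j. idx (top \<delta>) (s j)) {1..k \<delta>} (idx (top \<delta>) ` W \<delta>))"
  have s: "(\<forall>j\<in>{1..k \<delta>}. s \<delta> j \<in> W \<delta>) \<and>
      bij_betw (\<lambda>j. idx (top \<delta>) (s \<delta> j)) {1..k \<delta>} (idx (top \<delta>) ` W \<delta>)" if "\<delta> \<in> d ` H" for \<delta>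
    unfolding s_def by (rule someI_ex[OF ex_s[OF that]])
  define part where "part = (\<lambda>p. kernel_partition {1..k (d p)} (\<lambda>j. idx p (s (d p) j)))"
  have le_part: "le p q \<longleftrightarrow> refines {1..k (d p)} (part q) (part p)"
    if pq: "p \<in> H" "q \<in> H" "d p = d q" for p q
  proof -
    let ?\<delta> = "d p"
    have sW: "s ?\<delta> j \<in> W ?\<delta>" if "j \<in> {1..k ?\<delta>}" for j using s[of ?\<delta>] pq(1) that by blast
    have rep: "\<exists>j\<in>{1..k ?\<delta>}. idx p y = idx p (s ?\<delta> j) \<and> idx q y = idx q (s ?\<delta> j)" if y: "y \<in> W ?\<delta>" for y
    proof -
      have "idx (top ?\<delta>) y \<in> (\<lambda>j. idx (top ?\<delta>) (s ?\<delta> j)) ` {1..k ?\<delta>}"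
        using s[of ?\<delta>] pq(1) y by (simp add: bij_betw_def)
      then obtain j where j: "j \<in> {1..k ?\<delta>}" "idx (top ?\<delta>) y = idx (top ?\<delta>) (s ?\<delta> j)" by blast
      have "idx p y = idx p (s ?\<delta> j)"
        by (rule lek[OF pq(1) topH(1,3)[OF pq(1)] y sW[OF j(1)] j(2)])
      moreover have "idx q y = idx q (s ?\<delta> j)"
        by (rule lek[OF pq(2) topH(1,3)[OF pq(2)]]) (use pq(3) y sW[OF j(1)] j(2) in simp_all)
      ultimately show ?thesis using j(1) by blast
    qed
    have "le p q \<longleftrightarrow> (\<forall>i\<in>{1..k ?\<delta>}. \<forall>j\<in>{1..k ?\<delta>}. idx q (s ?\<delta> i) = idx q (s ?\<delta> j) \<longrightarrow> idx p (s ?\<delta> i) = idx p (s ?\<delta> j))"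
      (is "_ \<longleftrightarrow> ?R")
    proof
      assume l: "le p q"
      show ?R by (intro ballI impI) (rule lek[OF pq(1,2) l sW sW])
    next
      assume R: ?R
      show "le p q" unfolding le[OF pq(1,2)]
      proof (intro conjI ballI impI pq(3))
        fix y y' assume y: "y \<in> W ?\<delta>" "y' \<in> W ?\<delta>" "idx q y = idx q y'"
        obtain i where i: "i \<in> {1..k ?\<delta>}" "idx p y = idx p (s ?\<delta> i)" "idx q y = idx q (s ?\<delta> i)" using rep[OF y(1)] by blast
        obtain j where j: "j \<in> {1..k ?\<delta>}" "idx p y' = idx p (s ?\<delta> j)" "idx q y' = idx q (s ?\<delta> j)" using rep[OF y(2)] by blast
        show "idx p y = idx p y'" using bspec[OF bspec[OF R i(1)] j(1)] y(3) i(2,3) j(2,3) by simp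
      qed
    qed
    then show ?thesis unfolding part_def pq(3)[symmetric] refines_kernel_partition .
  qed
  define G where "G = (\<lambda>p. (E `` {top (d p)}, part p))"
  let ?Q = "disjoint_sum (maximal_elements P) (\<lambda>C. dual_poset (partition_lattice (the_elem (rank ` C))))"
  have fib: "the_elem (rank ` (E `` {top (d p)})) = k (d p)" if "p \<in> H" for p
    using rankC topH(1)[OF that] by (simp add: k_def)
  have G_le: "snd ?Q (G p) (G q) \<longleftrightarrow> le p q" if pq: "p \<in> H" "q \<in> H" for p q
  proof -
    have 1: "snd ?Q (G p) (G q) \<longleftrightarrow> E `` {top (d p)} = E `` {top (d q)} \<and> refines {1..k (d p)} (part q) (part p)"
      by (simp add: disjoint_sum_def G_def dual_poset_def partition_lattice_def fib[OF pq(1)])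
    have 2: "E `` {top (d p)} = E `` {top (d q)} \<longleftrightarrow> d p = d q"
    proof
      assume "E `` {top (d p)} = E `` {top (d q)}"
      then have "le (top (d p)) (top (d q))" using Eeq topH(1) pq by simp
      then show "d p = d q" using led[of "top (d p)" "top (d q)"] topH(1,2) pq by simp
    qed simp
    show ?thesis unfolding 1 2 using le_part[OF pq] led[OF pq] by blast
  qed
  have antisym: "G p = G q" if pq: "p \<in> H" "q \<in> H" "le p q" "le q p" for p q
  proof -
    have dd: "d p = d q" by (rule led[OF pq(1-3)])
    have "part p = part q"
      unfolding part_def dd[symmetric]
    proof (rule kernel_partition_eqI)
      fix i j assume "i \<in> {1..k (d p)}" "j \<in> {1..k (d p)}"
      then have "s (d p) i \<in> W (d p)" "s (d p) j \<in> W (d p)" using s[of "d p"] pq(1) by blast+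
      then show "idx p (s (d p) i) = idx p (s (d p) j) \<longleftrightarrow> idx q (s (d p) i) = idx q (s (d p) j)"
        using lek[OF pq(1-3)] lek[OF pq(2,1,4)] dd by metis
    qed
    then show ?thesis by (simp add: G_def dd)
  qed
  have G_in: "G p \<in> fst ?Q" if "p \<in> H" for p
    using that by (simp add: disjoint_sum_def G_def maxP fib dual_poset_def partition_lattice_def part_def
        partition_on_kernel_partition)
  have G_surj: "\<exists>p\<in>H. G p = z" if z: "z \<in> fst ?Q" for z
  proof -
    obtain C R where CR: "z = (C, R)" by (cases z)
    then have CR': "C \<in> maximal_elements P" "partition_on {1..the_elem (rank ` C)} R"
      using z by (simp_all add: disjoint_sum_def dual_poset_def partition_lattice_def)
    from CR'(1)[unfolded maxP] obtain p0 where p0: "p0 \<in> H" "C = E `` {top (d p0)}" by blast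
    then have p0: "p0 \<in> H" "z = (E `` {top (d p0)}, R)" "partition_on {1..k (d p0)} R"
      using CR'(2) CR fib[OF p0(1)] by simp_all
    let ?\<delta> = "d p0"
    obtain f :: "nat \<Rightarrow> nat" where f: "kernel_partition {1..k ?\<delta>} f = R"
      using partition_is_kernel_partition[OF p0(3)] by auto
    let ?e = "\<lambda>j. idx (top ?\<delta>) (s ?\<delta> j)"
    have inj: "inj_on ?e {1..k ?\<delta>}" using s[of ?\<delta>] p0(1) by (simp add: bij_betw_def)
    \<comment> \<open>The block labels \<open>f\<close> of \<open>R\<close> are carried along the
      inverse of \<open>?e\<close> to the values of \<open>idx (top ?\<delta>)\<close>; merging
      values with equal labels realises \<open>R\<close>.\<close>
    obtain q where q: "q \<in> H" "d q = ?\<delta>"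
      "\<forall>y\<in>W ?\<delta>. \<forall>y'\<in>W ?\<delta>. idx q y = idx q y' \<longleftrightarrow>
         f (inv_into {1..k ?\<delta>} ?e (idx (top ?\<delta>) y)) = f (inv_into {1..k ?\<delta>} ?e (idx (top ?\<delta>) y'))"
      using coarsen[OF topH(1)[OF p0(1)], of "\<lambda>i. f (inv_into {1..k ?\<delta>} ?e i)"] unfolding topH(2)[OF p0(1)] by blast
    have "part q = R"
      unfolding part_def q(2) f[symmetric]
    proof (rule kernel_partition_eqI)
      fix i j assume ij: "i \<in> {1..k ?\<delta>}" "j \<in> {1..k ?\<delta>}"
      then have "s ?\<delta> i \<in> W ?\<delta>" "s ?\<delta> j \<in> W ?\<delta>" using s[of ?\<delta>] p0(1) by blast+
      then show "idx q (s ?\<delta> i) = idx q (s ?\<delta> j) \<longleftrightarrow> f i = f j"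
        using q(3) inv_into_f_f[OF inj ij(1)] inv_into_f_f[OF inj ij(2)] by simp
    qed
    then show ?thesis using q(1,2) p0(2) by (intro bexI[of _ q]) (simp_all add: G_def)
  qed
  \<comment> \<open>\<open>G\<close> is defined on elements, so classes are represented;
    \<open>antisym\<close> makes the choice of representative immaterial.\<close>
  define rep where "rep = (\<lambda>C :: 'p set. SOME p. p \<in> C)"
  have rep: "rep C \<in> H" "E `` {rep C} = C" if "C \<in> H // E" for C
  proof -
    obtain p where p: "p \<in> H" "C = E `` {p}" using \<open>C \<in> H // E\<close> by (rule quotientE) blast
    have "p \<in> C" unfolding p(2) inE using p(1) refl by blast
    then have "rep C \<in> C" unfolding rep_def by (rule someI)
    then have r: "rep C \<in> H" "le p (rep C)" "le (rep C) p" using p(2) inE by blast+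
    show "rep C \<in> H" by (rule r(1))
    show "E `` {rep C} = C" using Eeq[OF r(1) p(1)] r p(2) by blast
  qed
  have fP: "fst P = H // E" by (simp add: P_def)
  have ord: "snd P C D \<longleftrightarrow> snd ?Q (G (rep C)) (G (rep D))" if "C \<in> H // E" "D \<in> H // E" for C D
    using Ple[OF rep(1)[OF that(1)] rep(1)[OF that(2)]] G_le[OF rep(1)[OF that(1)] rep(1)[OF that(2)]]
      rep(2)[OF that(1)] rep(2)[OF that(2)] by simp
  have "bij_betw (\<lambda>C. G (rep C)) (H // E) (fst ?Q)"
    unfolding bij_betw_def
  proof
    show "inj_on (\<lambda>C. G (rep C)) (H // E)"
    proof (rule inj_onI)
      fix C D assume CD: "C \<in> H // E" "D \<in> H // E" "G (rep C) = G (rep D)"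
      note H = rep(1)[OF CD(1)] rep(1)[OF CD(2)]
      have "le (rep C) (rep D)" "le (rep D) (rep C)"
        using G_le[OF H] G_le[OF H(2,1)] G_le[OF H(1,1)] refl[OF H(1)] CD(3) by simp_all
      then show "C = D" using Eeq[OF H] rep(2)[OF CD(1)] rep(2)[OF CD(2)] by simp
    qed
    show "(\<lambda>C. G (rep C)) ` (H // E) = fst ?Q"
    proof
      show "(\<lambda>C. G (rep C)) ` (H // E) \<subseteq> fst ?Q" using G_in rep(1) by blast
      show "fst ?Q \<subseteq> (\<lambda>C. G (rep C)) ` (H // E)"
      proof
        fix z assume "z \<in> fst ?Q"
        then obtain p where p: "p \<in> H" "G p = z" using G_surj by blast
        let ?C = "E `` {p}"
        have C: "?C \<in> H // E" using p(1) by (rule quotientI)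
        have "le (rep ?C) p" "le p (rep ?C)" using Eeq[OF rep(1)[OF C] p(1)] rep(2)[OF C] by simp_all
        then have "G (rep ?C) = z" using antisym[OF rep(1)[OF C] p(1)] p(2) by simp
        then show "z \<in> (\<lambda>C. G (rep C)) ` (H // E)" using C by blast
      qed
    qed
  qed
  then show ?thesis unfolding poset_iso_def fP using ord by blast
qed

section \<open>Homomorphisms from powers\<close>

text \<open>Fixing the coordinates in the finite set \<open>F\<close> gives an open set on which
  \<open>v\<close> is constant, so \<open>v\<close> is locally constant.\<close>

lemma continuous_map_dual_str_finite_support:
  assumes ego: "alter_ego \<sigma> M \<tau> N" and F: "finite F" "F \<subseteq> universe B"
    and v: "\<And>y. y \<in> alg_hom \<sigma> B M \<Longrightarrow> v y \<in> universe M"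
    and dep: "\<And>y z. \<lbrakk>y \<in> alg_hom \<sigma> B M; z \<in> alg_hom \<sigma> B M; \<forall>b\<in>F. z b = y b\<rbrakk> \<Longrightarrow> v z = v y"
  shows "continuous_map (topo (dual_str \<sigma> M N B)) (topo N) v"
proof -
  let ?T = "product_topology (\<lambda>_. discrete_topology (universe M)) (universe B)"
  let ?H = "alg_hom \<sigma> B M"
  have N: "topo N = discrete_topology (universe M)" using ego by (simp add: alter_ego_def)
  have HT: "?H \<subseteq> topspace ?T" by (auto simp: alg_hom_def)
  have top: "topspace (subtopology ?T ?H) = ?H" using HT by auto
  show ?thesis
    unfolding topo_dual_str[OF ego] N continuous_map_def top
  proof (intro conjI allI impI)
    show "v \<in> ?H \<rightarrow> topspace (discrete_topology (universe M))" using v by simp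
    fix V
    show "openin (subtopology ?T ?H) {y \<in> ?H. v y \<in> V}"
    proof (subst openin_subopen, rule ballI)
      fix y assume "y \<in> {y \<in> ?H. v y \<in> V}"
      then have y: "y \<in> ?H" "v y \<in> V" by auto
      let ?U = "{z \<in> universe B \<rightarrow>\<^sub>E universe M. \<forall>b\<in>F. z b = y b} \<inter> ?H"
      have "openin (subtopology ?T ?H) ?U"
        by (intro openin_subtopology_Int openin_agree_on_finite[OF F]) (use HT y(1) in auto)
      moreover have "y \<in> ?U" using HT y(1) by auto
      moreover have "?U \<subseteq> {y \<in> ?H. v y \<in> V}"
      proof
        fix z assume z: "z \<in> ?U"
        then have "v z = v y" by (intro dep[OF y(1)]) auto
        then show "z \<in> {y \<in> ?H. v y \<in> V}" using z y(2) by simp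
      qed
      ultimately show "\<exists>T. openin (subtopology ?T ?H) T \<and> y \<in> T \<and> T \<subseteq> {y \<in> ?H. v y \<in> V}" by blast
    qed
  qed
qed

section \<open>Arguments selected by characters\<close>

definition multi_diag :: "('a, 'f) alg \<Rightarrow> ('a, 'b) multi_fun \<Rightarrow> 'a \<Rightarrow> 'b" where
  "multi_diag A p = (\<lambda>x\<in>universe A. snd p (\<lambda>_\<in>{1..fst p}. x))"

text \<open>If the composite of \<open>y\<close> with the function factors through projection
  \<open>i\<close>, evaluating at constant tuples shows that the factor is \<open>y\<close> after
  the diagonal; this form is built in. When \<open>y\<close> is constant on the diagonal, one
  argument is selected only if all are.\<close>

definition selects :: "('a, 'f) alg \<Rightarrow> ('a, 'b) multi_fun \<Rightarrow> ('b \<Rightarrow> 'm) \<Rightarrow> nat \<Rightarrow> bool" where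
  "selects A p y i \<longleftrightarrow> i \<in> {1..fst p} \<and>
     (\<forall>a \<in> {1..fst p} \<rightarrow>\<^sub>E universe A. y (snd p a) = y (multi_diag A p (a i)))"

text \<open>For a character that is not moving this is an arbitrary choice, so kernels of
  \<open>selected\<close> are meaningful on \<open>moving\<close> only.\<close>

definition selected :: "('a, 'f) alg \<Rightarrow> ('a, 'b) multi_fun \<Rightarrow> ('b \<Rightarrow> 'm) \<Rightarrow> nat" where
  "selected A p y = (SOME i. selects A p y i)"

text \<open>Taking a diagonal rather than a function as parameter puts the kernels of all functions
  with this diagonal on a common set.\<close>

definition moving :: "('f \<rightharpoonup> nat) \<Rightarrow> ('m, 'f) alg \<Rightarrow> ('a, 'f) alg \<Rightarrow> ('b, 'f) alg \<Rightarrow> ('a \<Rightarrow> 'b) \<Rightarrow> ('b \<Rightarrow> 'm) set" where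
  "moving \<sigma> M A B \<delta> = {y \<in> alg_hom \<sigma> B M. \<exists>c\<in>universe A. \<exists>d\<in>universe A. y (\<delta> c) \<noteq> y (\<delta> d)}"

lemma multi_homsD:
  assumes "p \<in> multi_homs \<sigma> A B"
  shows "fst p \<ge> 1" "snd p \<in> alg_hom \<sigma> (alg_power A {1..fst p}) B"
    "\<And>a. a \<in> {1..fst p} \<rightarrow>\<^sub>E universe A \<Longrightarrow> snd p a \<in> universe B"
    "\<And>x. x \<in> universe A \<Longrightarrow> multi_diag A p x \<in> universe B"
proof -
  show n: "fst p \<ge> 1" and f: "snd p \<in> alg_hom \<sigma> (alg_power A {1..fst p}) B"
    using assms by (auto simp: multi_homs_def)
  show val: "snd p a \<in> universe B" if "a \<in> {1..fst p} \<rightarrow>\<^sub>E universe A" for a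
    using alg_homD(2)[OF f, of a] that by (simp add: universe_alg_power)
  show "multi_diag A p x \<in> universe B" if "x \<in> universe A" for x
    using val[of "\<lambda>_\<in>{1..fst p}. x"] that by (simp add: multi_diag_def)
qed

lemma selects_eq:
  assumes "selects A p y i" "a \<in> {1..fst p} \<rightarrow>\<^sub>E universe A"
  shows "y (snd p a) = y (multi_diag A p (a i))"
  using assms by (simp add: selects_def)

text \<open>On a tuple with \<open>c\<close> at position \<open>i\<close> and \<open>d\<close>
  elsewhere, two different selected positions would force two different values.\<close>

lemma selects_unique:
  assumes y: "y \<in> moving \<sigma> M A B (multi_diag A p)" and i: "selects A p y i" and j: "selects A p y j"
  shows "i = j"
proof (rule ccontr)
  assume ne: "i \<noteq> j"
  obtain c d where cd: "c \<in> universe A" "d \<in> universe A" "y (multi_diag A p c) \<noteq> y (multi_diag A p d)"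
    using y by (auto simp: moving_def)
  define a where "a = (\<lambda>k\<in>{1..fst p}. if k = i then c else d)"
  have a: "a \<in> {1..fst p} \<rightarrow>\<^sub>E universe A" using cd by (auto simp: a_def)
  have "a i = c" "a j = d" using i j ne by (simp_all add: a_def selects_def)
  then show False using selects_eq[OF i a] selects_eq[OF j a] cd(3) by simp
qed

lemma not_moving_eq:
  assumes "y \<in> alg_hom \<sigma> B M" "y \<notin> moving \<sigma> M A B \<delta>" "c \<in> universe A" "d \<in> universe A"
  shows "y (\<delta> c) = y (\<delta> d)"
  using assms unfolding moving_def by blast

locale logarithmic_pair =
  fixes \<sigma> :: "'f \<rightharpoonup> nat" and M :: "('m, 'f) alg"
    and \<tau> :: "('g, 'h, 'r) strsig" and N :: "('m, 'g, 'h, 'r) topstr"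
    and A B :: "('u, 'f) alg"
  assumes fin: "finite (universe M)"
    and ego: "alter_ego \<sigma> M \<tau> N"
    and log: "logarithmic_duality TYPE('u) TYPE(nat \<times> ('u \<Rightarrow> 'm)) \<sigma> M \<tau> N"
    and A_in: "in_ISP \<sigma> M A" and B_in: "in_ISP \<sigma> M B"
begin

abbreviation "homs \<equiv> multi_homs \<sigma> A B"
abbreviation "diag \<equiv> multi_diag A :: ('u, 'u) multi_fun \<Rightarrow> 'u \<Rightarrow> 'u"
abbreviation "chars \<equiv> alg_hom \<sigma> B M"
abbreviation "idx \<equiv> selected A :: ('u, 'u) multi_fun \<Rightarrow> ('u \<Rightarrow> 'm) \<Rightarrow> nat"
abbreviation "mov \<equiv> moving \<sigma> M A B"

lemma algA: "is_algebra \<sigma> A" and algB: "is_algebra \<sigma> B"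
  using A_in B_in by (simp_all add: in_ISP_def)

lemma evalB_iso: "alg_iso \<sigma> (eval_alg \<sigma> M B) B (dual_alg \<tau> M N (dual_str \<sigma> M N B))"
  using log B_in by (simp add: logarithmic_duality_def full_duality_def)

lemmas chars_separate = alg_iso_evalD(1)[OF evalB_iso]

text \<open>Relations of the dual of \<open>B\<close> hold pointwise, so composing related
  characters with a function into \<open>B\<close> gives pointwise related homomorphisms to
  \<open>M\<close>, which have a common factor index. A single character is the case of length
  1.\<close>

lemma common_selects:
  assumes p: "p \<in> homs" and ys: "set ys \<subseteq> chars"
    and rel: "length ys = 1 \<or> (\<exists>r k. rel_ar \<tau> r = Some k \<and> ys \<in> rels (dual_str \<sigma> M N B) r)"
  shows "\<exists>i. \<forall>y\<in>set ys. selects A p y i"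
proof -
  let ?P = "{1..fst p} \<rightarrow>\<^sub>E universe A"
  let ?w = "\<lambda>y. \<lambda>a\<in>universe (alg_power A {1..fst p}). y (snd p a)"
  have w: "?w y a = y (snd p a)" if "a \<in> ?P" for y a using that by (simp add: universe_alg_power)
  have "\<exists>i. \<forall>w\<in>set (map ?w ys). factors_at A (fst p) w i"
  proof (rule common_factor_index[OF ego fin log A_in multi_homsD(1)[OF p]])
    show "set (map ?w ys) \<subseteq> alg_hom \<sigma> (alg_power A {1..fst p}) M"
    proof -
      have "?w y \<in> alg_hom \<sigma> (alg_power A {1..fst p}) M" if "y \<in> chars" for y
        by (rule alg_hom_compose[OF is_algebra_alg_power[OF algA] multi_homsD(2)[OF p] that])
      then show ?thesis using ys unfolding set_map by blast
    qed
    show "length (map ?w ys) = 1 \<or> (\<exists>r k. rel_ar \<tau> r = Some k \<and>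
        (\<forall>a\<in>?P. map (\<lambda>w. w a) (map ?w ys) \<in> rels N r))"
      using rel
    proof
      assume "\<exists>r k. rel_ar \<tau> r = Some k \<and> ys \<in> rels (dual_str \<sigma> M N B) r"
      then obtain r k where r: "rel_ar \<tau> r = Some k" "ys \<in> rels (dual_str \<sigma> M N B) r" by (elim exE conjE)
      have "map (\<lambda>w. w a) (map ?w ys) \<in> rels N r" if a: "a \<in> ?P" for a
      proof -
        have "map (\<lambda>w. w a) (map ?w ys) = map (\<lambda>y. y (snd p a)) ys" using a by (simp add: universe_alg_power)
        moreover have "map (\<lambda>y. y (snd p a)) ys \<in> rels N r"
          using r(2) multi_homsD(3)[OF p a] unfolding rels_dual_str[OF ego] by blast
        ultimately show ?thesis by (simp only:)
      qed
      then show ?thesis using r(1) by blast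
    qed simp
  qed
  then obtain i where i: "\<forall>w\<in>set (map ?w ys). factors_at A (fst p) w i" ..
  have "selects A p y i" if "y \<in> set ys" for y
  proof -
    have f: "factors_at A (fst p) (?w y) i" using i that by simp
    then have iI: "i \<in> {1..fst p}" by (simp add: factors_at_def)
    show ?thesis unfolding selects_def
    proof (intro conjI ballI iI)
      fix a assume a: "a \<in> ?P"
      have c: "(\<lambda>_\<in>{1..fst p}. a i) \<in> ?P" using a iI by auto
      have "?w y a = ?w y (\<lambda>_\<in>{1..fst p}. a i)" using f a unfolding factors_at_def by blast
      then have "y (snd p a) = y (snd p (\<lambda>_\<in>{1..fst p}. a i))" unfolding w[OF a] w[OF c] .
      moreover have "a i \<in> universe A" using a iI by (rule PiE_mem)
      ultimately show "y (snd p a) = y (diag p (a i))" by (simp add: multi_diag_def)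
    qed
  qed
  then show ?thesis by blast
qed

lemma selects_idx:
  assumes "p \<in> homs" "y \<in> chars"
  shows "selects A p y (idx p y)"
proof -
  have "\<exists>i. selects A p y i" using common_selects[OF assms(1), of "[y]"] assms(2) by simp
  then show ?thesis unfolding selected_def by (rule someI_ex)
qed

lemma idx_eqI:
  assumes "p \<in> homs" "y \<in> mov (diag p)" "selects A p y i"
  shows "idx p y = i"
proof -
  have "y \<in> chars" using assms(2) by (simp add: moving_def)
  from selects_unique[OF assms(2) selects_idx[OF assms(1) this] assms(3)] show ?thesis .
qed

lemma idx_in:
  assumes "p \<in> homs" "y \<in> chars"
  shows "idx p y \<in> {1..fst p}"
  using selects_idx[OF assms] by (simp add: selects_def)

lemma mov_chars: "y \<in> mov \<delta> \<Longrightarrow> y \<in> chars"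
  by (simp add: moving_def)

text \<open>Reindexing turns constant tuples into constant tuples, and entry \<open>i\<close> of the
  reindexed tuple is \<open>a (t i)\<close>.\<close>

lemma minor_selects:
  assumes q: "q \<in> homs" and t: "t \<in> {1..fst q} \<rightarrow> {1..m}" and m: "m \<ge> 1"
    and g: "\<And>a. a \<in> {1..m} \<rightarrow>\<^sub>E universe A \<Longrightarrow> g a = snd q (reindex (fst q) t a)"
  shows "diag (m, g) = diag q"
    and "y \<in> chars \<Longrightarrow> selects A q y i \<Longrightarrow> selects A (m, g) y (t i)"
proof -
  show d: "diag (m, g) = diag q"
    unfolding multi_diag_def fst_conv snd_conv
  proof (rule restrict_ext)
    fix x assume x: "x \<in> universe A"
    have "reindex (fst q) t (\<lambda>_\<in>{1..m}. x) = (\<lambda>_\<in>{1..fst q}. x)"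
      unfolding reindex_def by (rule restrict_ext) (use t in auto)
    then show "g (\<lambda>_\<in>{1..m}. x) = snd q (\<lambda>_\<in>{1..fst q}. x)"
      using g[of "\<lambda>_\<in>{1..m}. x"] x by simp
  qed
  assume y: "y \<in> chars" and i: "selects A q y i"
  then have iI: "i \<in> {1..fst q}" by (simp add: selects_def)
  show "selects A (m, g) y (t i)"
    unfolding selects_def fst_conv snd_conv d
  proof (intro conjI ballI)
    show "t i \<in> {1..m}" using t iI by blast
    fix a assume a: "a \<in> {1..m} \<rightarrow>\<^sub>E universe A"
    have "reindex (fst q) t a \<in> {1..fst q} \<rightarrow>\<^sub>E universe A"
      unfolding reindex_def using t PiE_mem[OF a] by (intro restrict_PiE_iff[THEN iffD2] ballI) blast
    from selects_eq[OF i this] show "y (g a) = y (diag q (a (t i)))"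
      using g[OF a] iI by (simp add: reindex_def)
  qed
qed

text \<open>A minor along \<open>t\<close> replaces each selected argument by its image under
  \<open>t\<close>. Conversely, a map between selected arguments yields a reindexing, and the
  required equation in \<open>B\<close> may be tested on characters because these separate
  points.\<close>

lemma minor_le_iff:
  assumes p: "p \<in> homs" and q: "q \<in> homs"
  shows "minor_le A p q \<longleftrightarrow> diag p = diag q \<and>
    (\<forall>y\<in>mov (diag p). \<forall>y'\<in>mov (diag p). idx q y = idx q y' \<longrightarrow> idx p y = idx p y')"
    (is "?l \<longleftrightarrow> ?r")
proof -
  obtain m g n f where pq: "p = (m, g)" "q = (n, f)" by (metis surj_pair)
  note fs = pq fst_conv snd_conv
  have mn: "m \<ge> 1" "n \<ge> 1" using multi_homsD(1)[OF p] multi_homsD(1)[OF q] by (simp_all add: pq)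
  have le: "?l \<longleftrightarrow> (\<exists>t \<in> {1..n} \<rightarrow> {1..m}. \<forall>a \<in> {1..m} \<rightarrow>\<^sub>E universe A. g a = f (reindex n t a))"
    by (simp add: pq)
  show ?thesis
  proof
    assume ?l
    then obtain t where t: "t \<in> {1..n} \<rightarrow> {1..m}" "\<forall>a \<in> {1..m} \<rightarrow>\<^sub>E universe A. g a = f (reindex n t a)"
      unfolding le by blast
    have d: "diag p = diag q" and sel: "\<And>y i. y \<in> chars \<Longrightarrow> selects A q y i \<Longrightarrow> selects A p y (t i)"
      using minor_selects[OF q, of t m g] t mn by (simp_all add: pq)
    have "idx p y = t (idx q y)" if "y \<in> mov (diag p)" for y
      by (rule idx_eqI[OF p that sel[OF mov_chars[OF that] selects_idx[OF q mov_chars[OF that]]]])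
    then show ?r using d by simp
  next
    assume r: ?r
    then have d: "diag p = diag q" ..
    have "idx p y = idx p y'" if "y \<in> mov (diag p)" "y' \<in> mov (diag p)" "idx q y = idx q y'" for y y'
      using r that by blast
    then obtain h where h: "\<And>y. y \<in> mov (diag p) \<Longrightarrow> idx p y = h (idx q y)"
      using factor_through_kernel[of "mov (diag p)" "idx q" "idx p"] by blast
    \<comment> \<open>Outside the arguments selected by moving characters, \<open>h\<close> may
      leave the range. The default 1 is harmless there: every other character is constant on the
      diagonal.\<close>
    define t where "t = (\<lambda>i. if h i \<in> {1..m} then h i else 1)"
    have t: "t \<in> {1..n} \<rightarrow> {1..m}" using mn by (auto simp: t_def)
    have ti: "t (idx q y) = idx p y" if "y \<in> mov (diag p)" for y
      using h[OF that] idx_in[OF p mov_chars[OF that]] by (simp add: t_def pq)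
    have "g a = f (reindex n t a)" if a: "a \<in> {1..m} \<rightarrow>\<^sub>E universe A" for a
    proof -
      have ra: "reindex n t a \<in> {1..n} \<rightarrow>\<^sub>E universe A"
        unfolding reindex_def using t PiE_mem[OF a] by (intro restrict_PiE_iff[THEN iffD2] ballI) blast
      show ?thesis
      proof (rule chars_separate)
        show "g a \<in> universe B" using multi_homsD(3)[OF p] a by (simp add: pq)
        show "f (reindex n t a) \<in> universe B" using multi_homsD(3)[OF q] ra by (simp add: pq)
        fix y assume y: "y \<in> chars"
        note ip = idx_in[OF p y, unfolded fs] and iq = idx_in[OF q y, unfolded fs]
        have 1: "y (g a) = y (diag p (a (idx p y)))"
          using selects_eq[OF selects_idx[OF p y], of a] a by (simp add: pq)
        have "y (f (reindex n t a)) = y (diag q (reindex n t a (idx q y)))"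
          using selects_eq[OF selects_idx[OF q y], of "reindex n t a"] ra by (simp add: pq)
        also have "reindex n t a (idx q y) = a (t (idx q y))" using iq by (simp add: reindex_def pq)
        finally have 2: "y (f (reindex n t a)) = y (diag p (a (t (idx q y))))" by (simp add: d)
        show "y (g a) = y (f (reindex n t a))"
        proof (cases "y \<in> mov (diag p)")
          case True
          then show ?thesis using 1 2 ti by simp
        next
          case False
          have tm: "t (idx q y) \<in> {1..m}" using t iq by (auto simp: pq)
          have "a (idx p y) \<in> universe A" "a (t (idx q y)) \<in> universe A"
            using PiE_mem[OF a tm] PiE_mem[OF a] ip by (simp_all add: pq)
          from not_moving_eq[OF y False this] show ?thesis using 1 2 by simp
        qed
      qed
    qed
    then show ?l unfolding le using t by blast
  qed
qed

text \<open>A difference \<open>f a \<noteq> f b\<close> is seen by some character, which must read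
  the one coordinate where \<open>a\<close> and \<open>b\<close> differ. Conversely, changing the
  entry read by a moving character from \<open>c\<close> to \<open>d\<close> changes the
  value.\<close>

lemma ess_eq_card_idx:
  assumes p: "p \<in> homs"
  shows "ess A p = card (idx p ` mov (diag p))"
proof -
  obtain n f where nf: "p = (n, f)" by (cases p)
  let ?P = "{1..n} \<rightarrow>\<^sub>E universe A"
  let ?S = "{i \<in> {1..n}. \<exists>a \<in> ?P. \<exists>b \<in> ?P. (\<forall>j \<in> {1..n} - {i}. a j = b j) \<and> f a \<noteq> f b}"
  have val: "y (f a) = y (diag p (a (idx p y)))" if "y \<in> chars" "a \<in> ?P" for y a
    using selects_eq[OF selects_idx[OF p that(1)], of a] that(2) by (simp add: nf)
  have inI: "idx p y \<in> {1..n}" if "y \<in> chars" for y using idx_in[OF p that] by (simp add: nf)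
  have "?S = idx p ` mov (diag p)"
  proof
    show "?S \<subseteq> idx p ` mov (diag p)"
    proof
      fix i assume "i \<in> ?S"
      then obtain a b where ab: "a \<in> ?P" "b \<in> ?P" "\<forall>j \<in> {1..n} - {i}. a j = b j" "f a \<noteq> f b" by blast
      have "f a \<in> universe B" "f b \<in> universe B" using multi_homsD(3)[OF p] ab(1,2) by (simp_all add: nf)
      then obtain y where y: "y \<in> chars" "y (f a) \<noteq> y (f b)" using chars_separate[of "f a" "f b"] ab(4) by blast
      then have ne: "y (diag p (a (idx p y))) \<noteq> y (diag p (b (idx p y)))" using val[OF y(1) ab(1)] val[OF y(1) ab(2)] by simp
      have "idx p y = i"
      proof (rule ccontr)
        assume "idx p y \<noteq> i"
        then have "a (idx p y) = b (idx p y)" using ab(3) inI[OF y(1)] by blast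
        then show False using ne by simp
      qed
      moreover have "a (idx p y) \<in> universe A" "b (idx p y) \<in> universe A"
        using PiE_mem[OF ab(1) inI[OF y(1)]] PiE_mem[OF ab(2) inI[OF y(1)]] .
      then have "y \<in> mov (diag p)" using y(1) ne unfolding moving_def by blast
      ultimately show "i \<in> idx p ` mov (diag p)" by blast
    qed
    show "idx p ` mov (diag p) \<subseteq> ?S"
    proof (rule image_subsetI)
      fix y assume "y \<in> mov (diag p)"
      then obtain c d where y: "y \<in> chars" and cd: "c \<in> universe A" "d \<in> universe A" "y (diag p c) \<noteq> y (diag p d)"
        by (auto simp: moving_def)
      define a where "a = (\<lambda>_\<in>{1..n}. c)"
      define b where "b = (\<lambda>k\<in>{1..n}. if k = idx p y then d else c)"
      have P: "a \<in> ?P" "b \<in> ?P" using cd by (auto simp: a_def b_def)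
      have "y (f a) = y (diag p c)" using val[OF y P(1)] inI[OF y] by (simp add: a_def)
      moreover have "y (f b) = y (diag p d)" using val[OF y P(2)] inI[OF y] by (simp add: b_def)
      ultimately have "f a \<noteq> f b" using cd(3) by auto
      moreover have "\<forall>j \<in> {1..n} - {idx p y}. a j = b j" by (simp add: a_def b_def)
      ultimately show "idx p y \<in> ?S" using P inI[OF y] by blast
    qed
  qed
  then show ?thesis by (simp add: nf)
qed

lemma finite_idx_image: "p \<in> homs \<Longrightarrow> finite (idx p ` mov (diag p))"
  by (rule finite_subset[of _ "{1..fst p}"]) (use idx_in mov_chars in blast, simp)

lemma minor_hom:
  assumes q: "q \<in> homs" and t: "t \<in> {1..fst q} \<rightarrow> {1..m}" and m: "m \<ge> 1"
  shows "(m, \<lambda>a\<in>{1..m} \<rightarrow>\<^sub>E universe A. snd q (reindex (fst q) t a)) \<in> homs"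
proof -
  let ?n = "fst q"
  have re: "restrict (reindex ?n t) (universe (alg_power A {1..m})) \<in> alg_hom \<sigma> (alg_power A {1..m}) (alg_power A {1..?n})"
  proof (rule alg_homI)
    show ran: "restrict (reindex ?n t) (universe (alg_power A {1..m})) a \<in> universe (alg_power A {1..?n})"
      if "a \<in> universe (alg_power A {1..m})" for a
    proof -
      have a: "a \<in> {1..m} \<rightarrow>\<^sub>E universe A" using that by (simp add: universe_alg_power)
      have "reindex ?n t a \<in> {1..?n} \<rightarrow>\<^sub>E universe A"
        unfolding reindex_def using t PiE_mem[OF a] by (intro restrict_PiE_iff[THEN iffD2] ballI) blast
      then show ?thesis using a by (simp add: universe_alg_power)
    qed
    fix s k as assume s: "\<sigma> s = Some k" "length as = k" "set as \<subseteq> universe (alg_power A {1..m})"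
    have op: "oper (alg_power A {1..m}) s as \<in> universe (alg_power A {1..m})"
      by (rule is_algebraD(2)[OF is_algebra_alg_power[OF algA] s])
    have m1: "map (restrict (reindex ?n t) (universe (alg_power A {1..m}))) as = map (reindex ?n t) as"
      using s(3) by (simp add: subset_iff)
    have "reindex ?n t (oper (alg_power A {1..m}) s as) = oper (alg_power A {1..?n}) s (map (reindex ?n t) as)"
      unfolding oper_alg_power reindex_def
    proof (rule restrict_ext)
      fix i assume i: "i \<in> {1..?n}"
      then have "t i \<in> {1..m}" using t by blast
      moreover have "map (\<lambda>x. x i) (map (\<lambda>a. \<lambda>i\<in>{1..?n}. a (t i)) as) = map (\<lambda>x. x (t i)) as" using i by simp
      ultimately show "(\<lambda>i\<in>{1..m}. oper A s (map (\<lambda>x. x i) as)) (t i)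
          = oper A s (map (\<lambda>x. x i) (map (\<lambda>a. \<lambda>i\<in>{1..?n}. a (t i)) as))" by (simp only: restrict_apply' )
    qed
    then show "restrict (reindex ?n t) (universe (alg_power A {1..m})) (oper (alg_power A {1..m}) s as) =
        oper (alg_power A {1..?n}) s (map (restrict (reindex ?n t) (universe (alg_power A {1..m}))) as)"
      unfolding m1 using op by simp
  qed simp
  have "(\<lambda>a\<in>universe (alg_power A {1..m}). snd q (restrict (reindex ?n t) (universe (alg_power A {1..m})) a))
      \<in> alg_hom \<sigma> (alg_power A {1..m}) B"
    by (rule alg_hom_compose[OF is_algebra_alg_power[OF algA] re multi_homsD(2)[OF q]])
  moreover have "(\<lambda>a\<in>universe (alg_power A {1..m}). snd q (restrict (reindex ?n t) (universe (alg_power A {1..m})) a))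
      = (\<lambda>a\<in>{1..m} \<rightarrow>\<^sub>E universe A. snd q (reindex ?n t a))"
    unfolding universe_alg_power by (rule restrict_ext) simp
  ultimately show ?thesis using m by (simp add: multi_homs_def)
qed

lemma coarsen:
  fixes t :: "nat \<Rightarrow> nat"
  assumes q: "q \<in> homs"
  shows "\<exists>p\<in>homs. diag p = diag q \<and>
    (\<forall>y\<in>mov (diag q). \<forall>y'\<in>mov (diag q). idx p y = idx p y' \<longleftrightarrow> t (idx q y) = t (idx q y'))"
proof -
  \<comment> \<open>\<open>Suc\<close> shifts the labels into positions from 1 on without altering
    their kernel, and \<open>m\<close> is the largest position used.\<close>
  define m where "m = Suc (Max (t ` {1..fst q}))"
  have n: "{1..fst q} \<noteq> {}" using multi_homsD(1)[OF q] by simp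
  have t: "(\<lambda>i. Suc (t i)) \<in> {1..fst q} \<rightarrow> {1..m}" by (auto simp: m_def)
  have m: "m \<ge> 1" by (simp add: m_def)
  let ?g = "\<lambda>a\<in>{1..m} \<rightarrow>\<^sub>E universe A. snd q (reindex (fst q) (\<lambda>i. Suc (t i)) a)"
  note p = minor_hom[OF q t m]
  have g: "?g a = snd q (reindex (fst q) (\<lambda>i. Suc (t i)) a)" if "a \<in> {1..m} \<rightarrow>\<^sub>E universe A" for a
    using that by simp
  have d: "diag (m, ?g) = diag q" by (rule minor_selects(1)[OF q t m g])
  have "idx (m, ?g) y = Suc (t (idx q y))" if y: "y \<in> mov (diag q)" for y
  proof (rule idx_eqI[OF p])
    show "y \<in> mov (diag (m, ?g))" unfolding d by (rule y)
    show "selects A (m, ?g) y (Suc (t (idx q y)))"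
      by (rule minor_selects(2)[OF q t m g mov_chars[OF y] selects_idx[OF q mov_chars[OF y]]])
  qed
  then have "\<forall>y\<in>mov (diag q). \<forall>y'\<in>mov (diag q). idx (m, ?g) y = idx (m, ?g) y' \<longleftrightarrow> t (idx q y) = t (idx q y')"
    by simp
  then show ?thesis using p d by blast
qed

section \<open>Common refinement over a fixed diagonal\<close>

text \<open>Meant for \<open>y\<close> obtained from \<open>x\<close> by a unary operation of the
  dual: an equality between values of \<open>x\<close> passes to \<open>y\<close>, so the equation
  that expresses selection does too.\<close>

lemma selects_transfer:
  assumes p: "p \<in> homs" and i: "selects A p x i"
    and xy: "\<And>b b'. \<lbrakk>b \<in> universe B; b' \<in> universe B; x b = x b'\<rbrakk> \<Longrightarrow> y b = y b'"
  shows "selects A p y i"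
proof -
  have iI: "i \<in> {1..fst p}" using i by (simp add: selects_def)
  show ?thesis unfolding selects_def
  proof (intro conjI ballI iI)
    fix a assume a: "a \<in> {1..fst p} \<rightarrow>\<^sub>E universe A"
    show "y (snd p a) = y (diag p (a i))"
      by (rule xy[OF multi_homsD(3)[OF p a] multi_homsD(4)[OF p PiE_mem[OF a iI]] selects_eq[OF i a]])
  qed
qed

text \<open>If \<open>z\<close> read another argument than \<open>y\<close>, the tuple with
  \<open>c\<close> at the argument of \<open>y\<close> and \<open>d\<close> elsewhere would tell
  them apart. For finite \<open>E\<close> the selected argument is thus fixed by finitely many
  values of the character, which is what continuity needs.\<close>

lemma idx_determined:
  assumes p: "p \<in> homs" and y: "y \<in> chars" and z: "z \<in> chars" and E: "E \<subseteq> universe A"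
    and agree: "\<And>t. t \<in> {1..fst p} \<rightarrow>\<^sub>E E \<Longrightarrow> z (snd p t) = y (snd p t)"
    and cd: "c \<in> E" "d \<in> E" "y (diag p c) \<noteq> y (diag p d)"
  shows "idx p z = idx p y"
proof (rule ccontr)
  assume ne: "idx p z \<noteq> idx p y"
  have diag: "z (diag p e) = y (diag p e)" if "e \<in> E" for e
    using agree[of "\<lambda>_\<in>{1..fst p}. e"] that E by (auto simp: multi_diag_def)
  define t where "t = (\<lambda>k\<in>{1..fst p}. if k = idx p y then c else d)"
  have tE: "t \<in> {1..fst p} \<rightarrow>\<^sub>E E" using cd by (auto simp: t_def)
  then have tA: "t \<in> {1..fst p} \<rightarrow>\<^sub>E universe A" using E by auto
  have "y (snd p t) = y (diag p c)"
    using selects_eq[OF selects_idx[OF p y] tA] idx_in[OF p y] by (simp add: t_def)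
  moreover have "z (snd p t) = z (diag p d)"
    using selects_eq[OF selects_idx[OF p z] tA] idx_in[OF p z] ne by (simp add: t_def)
  ultimately show False using agree[OF tE] diag[OF cd(2)] cd(3) by simp
qed

text \<open>In the common refinement of \<open>p\<close> and \<open>q\<close>, the argument that \<open>y\<close> depends on is the pair of the
  arguments that it depends on in \<open>p\<close> and in \<open>q\<close>. The values of the refinement exist because, for a fixed
  tuple of arguments, the prescribed values form a morphism from the dual of \<open>B\<close> to \<open>N\<close>.\<close>

lemma joint_value_exists:
  fixes \<kappa> :: "nat \<times> nat \<Rightarrow> nat"
  assumes p: "p \<in> homs" and q: "q \<in> homs" and d: "diag p = diag q"
    and \<kappa>: "\<And>i j. \<lbrakk>i \<in> {1..fst p}; j \<in> {1..fst q}\<rbrakk> \<Longrightarrow> \<kappa> (i, j) \<in> {1..l}"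
    and a: "a \<in> {1..l} \<rightarrow>\<^sub>E universe A"
  shows "\<exists>b\<in>universe B. \<forall>y\<in>chars. y b = y (diag p (a (\<kappa> (idx p y, idx q y))))"
proof -
  let ?D = "dual_str \<sigma> M N B"
  define val where "val = (\<lambda>y :: 'u \<Rightarrow> 'm. y (diag p (a (\<kappa> (idx p y, idx q y)))))"
  define v where "v = (\<lambda>y\<in>chars. val y)"
  note pts = points_dual_str[OF ego, of B]
  note DB = is_topstr_dual_str[OF ego algB]
  have aA: "a (\<kappa> (i, j)) \<in> universe A" if "i \<in> {1..fst p}" "j \<in> {1..fst q}" for i j
    using PiE_mem[OF a \<kappa>[OF that]] .
  have dB: "diag p (a (\<kappa> (i, j))) \<in> universe B" if "i \<in> {1..fst p}" "j \<in> {1..fst q}" for i j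
    by (rule multi_homsD(4)[OF p aA[OF that]])
  \<comment> \<open>The prescribed value may be computed with any pair of selecting arguments, not
    only the chosen ones: they coincide for a moving character, and otherwise the entry of
    \<open>a\<close> is irrelevant.\<close>
  have v_sel: "v y = y (diag p (a (\<kappa> (i, j))))"
    if y: "y \<in> chars" and i: "selects A p y i" and j: "selects A q y j" for y i j
  proof (cases "y \<in> mov (diag p)")
    case True
    then have "idx p y = i" "idx q y = j" using idx_eqI[OF p _ i] idx_eqI[OF q _ j] d by simp_all
    then show ?thesis using y by (simp add: v_def val_def)
  next
    case False
    have ij: "i \<in> {1..fst p}" "j \<in> {1..fst q}" using i j by (simp_all add: selects_def)
    show ?thesis
      using not_moving_eq[OF y False aA[OF idx_in[OF p y] idx_in[OF q y]] aA[OF ij]] y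
      by (simp add: v_def val_def)
  qed
  have "v \<in> str_hom \<tau> ?D N"
  proof (rule str_homI)
    show "v \<in> extensional (points ?D)" by (simp add: v_def pts)
    \<comment> \<open>For the fixed tuple \<open>a\<close>, only its entries enter the prescribed
      values. A character is tested on the values of \<open>p\<close> and \<open>q\<close> at tuples
      over these entries, a finite set \<open>F\<close>.\<close>
    define E where "E = a ` {1..l}"
    have EA: "E \<subseteq> universe A" using PiE_mem[OF a] by (auto simp: E_def)
    have finE: "finite E" by (simp add: E_def)
    define F where "F = snd p ` ({1..fst p} \<rightarrow>\<^sub>E E) \<union> snd q ` ({1..fst q} \<rightarrow>\<^sub>E E)"
    have tA: "t \<in> {1..n} \<rightarrow>\<^sub>E universe A" if "t \<in> {1..n} \<rightarrow>\<^sub>E E" for t and n :: nat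
      using that EA by auto
    show "continuous_map (topo ?D) (topo N) v"
    proof (rule continuous_map_dual_str_finite_support[OF ego])
      show "finite F" unfolding F_def using finE by (intro finite_UnI finite_imageI finite_PiE) auto
      show "F \<subseteq> universe B" unfolding F_def
        using multi_homsD(3)[OF p tA] multi_homsD(3)[OF q tA] by blast
      show "v y \<in> universe M" if y: "y \<in> chars" for y
        using alg_homD(2)[OF y dB[OF idx_in[OF p y] idx_in[OF q y]]] y by (simp add: v_def val_def)
      fix y z assume y: "y \<in> chars" and z: "z \<in> chars" and F: "\<forall>b\<in>F. z b = y b"
      have agp: "z (snd p t) = y (snd p t)" if "t \<in> {1..fst p} \<rightarrow>\<^sub>E E" for t using F that by (simp add: F_def)
      have agq: "z (snd q t) = y (snd q t)" if "t \<in> {1..fst q} \<rightarrow>\<^sub>E E" for t using F that by (simp add: F_def)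
      have diag: "z (diag p e) = y (diag p e)" if "e \<in> E" for e
        using agp[of "\<lambda>_\<in>{1..fst p}. e"] that EA by (auto simp: multi_diag_def)
      have ez: "a (\<kappa> (idx p z, idx q z)) \<in> E" and ey: "a (\<kappa> (idx p y, idx q y)) \<in> E"
        unfolding E_def by (intro imageI \<kappa> idx_in[OF p] idx_in[OF q] y z)+
      show "v z = v y"
      \<comment> \<open>Either \<open>y\<close> moves the diagonal on \<open>E\<close>, and
        agreement on \<open>F\<close> fixes both arguments, or \<open>y\<close> is constant on the
        diagonal over \<open>E\<close>, and the entry does not matter.\<close>
      proof (cases "\<exists>c\<in>E. \<exists>d\<in>E. y (diag p c) \<noteq> y (diag p d)")
        case True
        then obtain c e where ce: "c \<in> E" "e \<in> E" "y (diag p c) \<noteq> y (diag p e)" by blast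
        have "idx p z = idx p y" by (rule idx_determined[OF p y z EA agp ce])
        moreover have "idx q z = idx q y" by (rule idx_determined[OF q y z EA agq ce[unfolded d]])
        ultimately show ?thesis using y z diag[OF ey] by (simp add: v_def val_def)
      next
        case False
        then have "y (diag p (a (\<kappa> (idx p z, idx q z)))) = y (diag p (a (\<kappa> (idx p y, idx q y))))" using ez ey by blast
        then show ?thesis using y z diag[OF ez] by (simp add: v_def val_def)
      qed
    qed
  next
    fix g n xs assume g: "tot_ar \<tau> g = Some n" "length xs = n" "set xs \<subseteq> points ?D"
    let ?y = "tot_op ?D g xs"
    have y: "?y \<in> chars" using is_topstrD(1)[OF DB g] by (simp add: pts)
    have "n \<le> 1" using log g(1) by (simp add: logarithmic_duality_def)
    then consider "xs = []" | x where "xs = [x]" using g(2) by (cases xs) auto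
    then show "v ?y = tot_op N g (map v xs)"
    proof cases
      case 1
      then have yb: "?y b = tot_op N g []" if "b \<in> universe B" for b using that by (simp add: tot_op_dual_str)
      have "v ?y = ?y (diag p (a (\<kappa> (idx p ?y, idx q ?y))))"
        by (rule v_sel[OF y selects_idx[OF p y] selects_idx[OF q y]])
      also have "\<dots> = tot_op N g []" by (rule yb[OF dB[OF idx_in[OF p y] idx_in[OF q y]]])
      finally show ?thesis by (simp add: 1)
    next
      case (2 x)
      then have x: "x \<in> chars" using g(3) by (simp add: pts)
      have yx: "?y b = tot_op N g [x b]" if "b \<in> universe B" for b using that 2 by (simp add: tot_op_dual_str)
      have tr: "?y b = ?y b'" if "b \<in> universe B" "b' \<in> universe B" "x b = x b'" for b b'
        using yx[OF that(1)] yx[OF that(2)] that(3) by simp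
      note sp = selects_idx[OF p x] and sq = selects_idx[OF q x]
      have "v ?y = ?y (diag p (a (\<kappa> (idx p x, idx q x))))"
        by (rule v_sel[OF y selects_transfer[OF p sp tr] selects_transfer[OF q sq tr]])
      also have "\<dots> = tot_op N g [v x]"
        using yx[OF dB[OF idx_in[OF p x] idx_in[OF q x]]] v_sel[OF x sp sq] by simp
      finally show ?thesis by (simp add: 2)
    qed
  next
    fix h n xs y assume h: "par_ar \<tau> h = Some n" "par_op ?D h xs = Some y"
    note P = h(2)[unfolded par_op_dual_str[OF ego]]
    have y: "y \<in> chars" and len: "length xs = n" using is_topstrD(2)[OF DB h] by (simp_all add: pts)
    have yx: "par_op N h (map (\<lambda>x. x b) xs) = Some (y b)" if "b \<in> universe B" for b using P that by blast
    have "n \<le> 1" using log h(1) by (simp add: logarithmic_duality_def)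
    then consider "xs = []" | x where "xs = [x]" using len by (cases xs) auto
    then show "par_op N h (map v xs) = Some (v y)"
    proof cases
      case 1
      then show ?thesis using y yx[OF dB[OF idx_in[OF p y] idx_in[OF q y]]] by (simp add: v_def val_def)
    next
      case (2 x)
      then have x: "x \<in> chars" using P by simp
      have yx1: "par_op N h [x b] = Some (y b)" if "b \<in> universe B" for b using yx[OF that] 2 by simp
      have tr: "y b = y b'" if "b \<in> universe B" "b' \<in> universe B" "x b = x b'" for b b'
        using yx1[OF that(1)] yx1[OF that(2)] that(3) by simp
      note sp = selects_idx[OF p x] and sq = selects_idx[OF q x]
      have "v y = y (diag p (a (\<kappa> (idx p x, idx q x))))"
        by (rule v_sel[OF y selects_transfer[OF p sp tr] selects_transfer[OF q sq tr]])
      then show ?thesis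
        using yx1[OF dB[OF idx_in[OF p x] idx_in[OF q x]]] v_sel[OF x sp sq] by (simp add: 2)
    qed
  next
    fix r n xs assume r: "rel_ar \<tau> r = Some n" "xs \<in> rels ?D r"
    note R = r(2)[unfolded rels_dual_str[OF ego]]
    have rel: "length xs = 1 \<or> (\<exists>r k. rel_ar \<tau> r = Some k \<and> xs \<in> rels ?D r)" using r by blast
    \<comment> \<open>Common arguments \<open>i\<close> and \<open>j\<close> let \<open>v\<close>
      evaluate all related characters at one and the same element of \<open>B\<close>, where the
      relation holds.\<close>
    obtain i where i: "\<forall>y\<in>set xs. selects A p y i" using common_selects[OF p conjunct1[OF R] rel] ..
    obtain j where j: "\<forall>y\<in>set xs. selects A q y j" using common_selects[OF q conjunct1[OF R] rel] ..
    show "map v xs \<in> rels N r"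
    proof (cases xs)
      \<comment> \<open>The empty list provides no indices; its membership in the relation is read
        off at any element of \<open>B\<close>.\<close>
      case Nil
      then show ?thesis using R is_algebraD(1)[OF algB] by auto
    next
      case (Cons x xs')
      then have "selects A p x i" "selects A q x j" using i j by simp_all
      then have "diag p (a (\<kappa> (i, j))) \<in> universe B" by (intro dB) (simp_all add: selects_def)
      then have "map (\<lambda>x. x (diag p (a (\<kappa> (i, j))))) xs \<in> rels N r" using R by blast
      moreover have "map v xs = map (\<lambda>x. x (diag p (a (\<kappa> (i, j))))) xs"
      proof (rule map_cong[OF refl])
        fix y assume "y \<in> set xs"
        then show "v y = y (diag p (a (\<kappa> (i, j))))" using v_sel[of y i j] i j R by blast
      qed
      ultimately show ?thesis by (simp only:)
    qed
  qed
  from alg_iso_evalD(3)[OF evalB_iso this] obtain b where b: "b \<in> universe B" "\<forall>y\<in>chars. v y = y b" ..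
  show ?thesis
  proof (intro bexI[OF _ b(1)] ballI)
    fix y assume "y \<in> chars"
    from bspec[OF b(2) this] this show "y b = y (diag p (a (\<kappa> (idx p y, idx q y))))"
      by (simp add: v_def val_def)
  qed
qed

text \<open>The arguments of the upper bound are the pairs of arguments of \<open>p\<close> and
  \<open>q\<close>, numbered by \<open>\<kappa>\<close>, so its kernel is the intersection of the
  two kernels. Its values are determined by their characters, so it is enough to verify the
  homomorphism law and the diagonal one character at a time.\<close>

lemma directed:
  assumes p: "p \<in> homs" and q: "q \<in> homs" and d: "diag p = diag q"
  shows "\<exists>r\<in>homs. minor_le A p r \<and> minor_le A q r"
proof -
  define l where "l = fst p * fst q"
  have l: "l \<ge> 1" using multi_homsD(1)[OF p] multi_homsD(1)[OF q] by (simp add: l_def)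
  obtain \<kappa> where \<kappa>: "bij_betw \<kappa> ({1..fst p} \<times> {1..fst q}) {1..l}"
    using finite_same_card_bij[of "{1..fst p} \<times> {1..fst q}" "{1..l}"] by (auto simp: l_def)
  have \<kappa>I: "\<kappa> (i, j) \<in> {1..l}" if "i \<in> {1..fst p}" "j \<in> {1..fst q}" for i j
    using bij_betw_apply[OF \<kappa>, of "(i, j)"] that by simp
  let ?P = "{1..l} \<rightarrow>\<^sub>E universe A" and ?k = "\<lambda>y. \<kappa> (idx p y, idx q y)"
  have kI: "?k y \<in> {1..l}" if "y \<in> chars" for y by (rule \<kappa>I[OF idx_in[OF p that] idx_in[OF q that]])
  define h where "h = (\<lambda>a\<in>?P. SOME b. b \<in> universe B \<and> (\<forall>y\<in>chars. y b = y (diag p (a (?k y)))))"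
  have hB: "h a \<in> universe B" and hy: "\<And>y. y \<in> chars \<Longrightarrow> y (h a) = y (diag p (a (?k y)))" if a: "a \<in> ?P" for a
  proof -
    have "\<exists>b. b \<in> universe B \<and> (\<forall>y\<in>chars. y b = y (diag p (a (?k y))))"
      unfolding Bex_def[symmetric] by (rule joint_value_exists[OF p q d _ a]) (rule \<kappa>I)
    from someI_ex[OF this] have "h a \<in> universe B \<and> (\<forall>y\<in>chars. y (h a) = y (diag p (a (?k y))))"
      using a by (simp add: h_def)
    then show "h a \<in> universe B" "\<And>y. y \<in> chars \<Longrightarrow> y (h a) = y (diag p (a (?k y)))" by blast+
  qed
  let ?A = "alg_power A {1..l}"
  have "h \<in> alg_hom \<sigma> ?A B"
  proof (rule alg_homI)
    show "h \<in> extensional (universe ?A)" by (simp add: h_def universe_alg_power)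
    show "h a \<in> universe B" if "a \<in> universe ?A" for a using hB that by (simp add: universe_alg_power)
    fix s n as assume s: "\<sigma> s = Some n" "length as = n" "set as \<subseteq> universe ?A"
    have asP: "set as \<subseteq> ?P" using s(3) by (simp add: universe_alg_power)
    have op: "oper ?A s as \<in> ?P"
      using is_algebraD(2)[OF is_algebra_alg_power[OF algA] s] by (simp add: universe_alg_power)
    have hs: "set (map h as) \<subseteq> universe B" using hB asP by auto
    show "h (oper ?A s as) = oper B s (map h as)"
    proof (rule chars_separate)
      show "h (oper ?A s as) \<in> universe B" by (rule hB[OF op])
      show "oper B s (map h as) \<in> universe B" by (rule is_algebraD(2)[OF algB s(1) _ hs]) (simp add: s(2))
      fix y assume y: "y \<in> chars"
      \<comment> \<open>Followed by \<open>y\<close>, the map \<open>h\<close> becomes the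
        projection to \<open>?k y\<close> followed by this homomorphism.\<close>
      let ?\<delta> = "\<lambda>x\<in>universe A. y (diag p x)"
      have dg: "?\<delta> \<in> alg_hom \<sigma> A M"
      proof -
        let ?c = "\<lambda>x. \<lambda>_\<in>{1..fst p}. x"
        have c: "restrict ?c (universe A) \<in> alg_hom \<sigma> A (alg_power A {1..fst p})"
        proof (rule alg_homI)
          show "restrict ?c (universe A) x \<in> universe (alg_power A {1..fst p})" if "x \<in> universe A" for x
            using that by (auto simp: universe_alg_power)
          fix s n xs assume s: "\<sigma> s = Some n" "length xs = n" "set xs \<subseteq> universe A"
          have "map (\<lambda>x. x i) (map (restrict ?c (universe A)) xs) = xs" if "i \<in> {1..fst p}" for i
            using s(3) that by (simp add: map_idI subset_iff)
          then have "oper (alg_power A {1..fst p}) s (map (restrict ?c (universe A)) xs) = ?c (oper A s xs)"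
            unfolding oper_alg_power by (intro restrict_ext) (simp only:)
          then show "restrict ?c (universe A) (oper A s xs) = oper (alg_power A {1..fst p}) s (map (restrict ?c (universe A)) xs)"
            using is_algebraD(2)[OF algA s] by simp
        qed simp
        have "(\<lambda>x\<in>universe A. snd p (restrict ?c (universe A) x)) \<in> alg_hom \<sigma> A B"
          by (rule alg_hom_compose[OF algA c multi_homsD(2)[OF p]])
        moreover have "(\<lambda>x\<in>universe A. snd p (restrict ?c (universe A) x)) = diag p"
          unfolding multi_diag_def by (rule restrict_ext) simp
        ultimately have "diag p \<in> alg_hom \<sigma> A B" by simp
        then show ?thesis by (rule alg_hom_compose[OF algA _ y])
      qed
      have xs: "set (map (\<lambda>a. a (?k y)) as) \<subseteq> universe A" using PiE_mem[OF _ kI[OF y], of _ "\<lambda>_. universe A"] asP by auto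
      have "y (h (oper ?A s as)) = ?\<delta> (oper A s (map (\<lambda>a. a (?k y)) as))"
        using hy[OF op y] kI[OF y] is_algebraD(2)[OF algA s(1) _ xs] s(2) by (simp add: oper_alg_power)
      also have "\<dots> = oper M s (map ?\<delta> (map (\<lambda>a. a (?k y)) as))"
        by (rule alg_homD(3)[OF dg s(1) _ xs]) (simp add: s(2))
      also have "map ?\<delta> (map (\<lambda>a. a (?k y)) as) = map y (map h as)"
        unfolding map_map o_def
      proof (rule map_cong[OF refl])
        fix a assume "a \<in> set as"
        then have a: "a \<in> ?P" using asP by blast
        show "?\<delta> (a (?k y)) = y (h a)" unfolding hy[OF a y] using PiE_mem[OF a kI[OF y]] by simp
      qed
      also have "oper M s (map y (map h as)) = y (oper B s (map h as))"
        by (rule alg_homD(3)[OF y s(1) _ hs, symmetric]) (simp add: s(2))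
      finally show "y (h (oper ?A s as)) = y (oper B s (map h as))" .
    qed
  qed
  then have r: "(l, h) \<in> homs" using l by (simp add: multi_homs_def)
  have dr: "diag (l, h) = diag p"
  proof (rule extensionalityI[of _ "universe A"])
    fix x assume x: "x \<in> universe A"
    then have c: "(\<lambda>_\<in>{1..l}. x) \<in> ?P" by auto
    have "h (\<lambda>_\<in>{1..l}. x) = diag p x"
    proof (rule chars_separate[OF hB[OF c] multi_homsD(4)[OF p x]])
      show "y (h (\<lambda>_\<in>{1..l}. x)) = y (diag p x)" if "y \<in> chars" for y
        unfolding hy[OF c that] using kI[OF that] by simp
    qed
    then show "diag (l, h) x = diag p x" using x by (simp add: multi_diag_def)
  qed (simp_all add: multi_diag_def)
  have idx: "idx (l, h) y = ?k y" if y: "y \<in> mov (diag p)" for y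
  proof (rule idx_eqI[OF r])
    show "y \<in> mov (diag (l, h))" unfolding dr by (rule y)
    show "selects A (l, h) y (?k y)"
      unfolding selects_def fst_conv snd_conv dr
      by (intro conjI ballI kI hy mov_chars[OF y])
  qed
  have inj: "idx p y = idx p y' \<and> idx q y = idx q y'"
    if y: "y \<in> mov (diag p)" "y' \<in> mov (diag p)" "idx (l, h) y = idx (l, h) y'" for y y'
  proof -
    have "?k y = ?k y'" using y(3) unfolding idx[OF y(1)] idx[OF y(2)] .
    moreover have "(idx p z, idx q z) \<in> {1..fst p} \<times> {1..fst q}" if "z \<in> mov (diag p)" for z
      using idx_in[OF p mov_chars[OF that]] idx_in[OF q mov_chars[OF that]] by (rule SigmaI)
    ultimately show ?thesis using inj_onD[OF bij_betw_imp_inj_on[OF \<kappa>], of "(idx p y, idx q y)" "(idx p y', idx q y')"] y(1,2)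
      by blast
  qed
  have "minor_le A p (l, h)" unfolding minor_le_iff[OF p r] dr using inj by blast
  moreover have "minor_le A q (l, h)" unfolding minor_le_iff[OF q r] dr d[symmetric] using inj by blast
  ultimately show ?thesis using r by blast
qed

end

theorem theorem5p5:
  fixes \<sigma> :: "'f \<rightharpoonup> nat" and M :: "('m, 'f) alg"
    and \<tau> :: "('g, 'h, 'r) strsig" and N :: "('m, 'g, 'h, 'r) topstr"
    and A B :: "('u, 'f) alg"
  assumes "is_algebra \<sigma> M" and "finite (universe M)"
    and "alter_ego \<sigma> M \<tau> N"
    and "logarithmic_duality TYPE('u) TYPE(nat \<times> ('u \<Rightarrow> 'm)) \<sigma> M \<tau> N"
    and "in_ISP \<sigma> M A" and "in_ISP \<sigma> M B"
    and "bdd_above (ess A ` multi_homs \<sigma> A B)"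
  shows "poset_iso (minor_poset \<sigma> A B)
           (disjoint_sum (maximal_elements (minor_poset \<sigma> A B))
              (\<lambda>C. dual_poset (partition_lattice (class_ess A C))))"
proof -
  interpret logarithmic_pair \<sigma> M \<tau> N A B
    using assms(2-6) by unfold_locales
  show ?thesis
    unfolding minor_poset_def minor_equiv_def class_ess_def
    by (rule kernel_preorder_poset_iso[where d = diag and W = mov and idx = idx])
      (rule minor_le_iff ess_eq_card_idx finite_idx_image directed coarsen assms(7); assumption?)+
qed

end
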